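(* Let $d\ge 1$, let $G$ be a compact Lie group of dimension $d'$ with a fixed maximal torus $\mathcal{T}$ with Lie algebra $\mathfrak{t}$, and let $\alpha\in\mathbb{T}^d$ be Diophantine. The fibered rotation vector is a total invariant for $H^{-d-d'}$ conjugation of almost reducible cocycles over $\alpha$, in the following sense: every almost reducible cocycle $\Phi=(\alpha,A(\cdot))$, $A(\cdot)\in C^\infty(\mathbb{T}^d,G)$, is $H^{-d-d'}$ conjugate to a constant cocycle $(\alpha,\exp(a))$ where $a\in\mathfrak{t}$ is the corresponding rotation vector, $a=\varrho(\Phi)$.
   Context: $\mathbb{T}^d=\mathbb{R}^d/\mathbb{Z}^d$. A vector $\alpha\in\mathbb{T}^d$ is Diophantine if there are $\gamma,\tau>0$ with $|\alpha\cdot k|_{\mathbb{Z}}\ge \gamma^{-1}|k|^{-\tau}$ for all $k\in\mathbb{Z}^d\setminus\{0\}$, where $|\cdot|_{\mathbb{Z}}$ is the distance to the nearest integer. A (smooth quasi-periodic) cocycle over $\alpha$ is a pair $\Phi=(\alpha,A(\cdot))$ with $A(\cdot)\in C^\infty(\mathbb{T}^d,G)$, acting on $\mathbb{T}^d\times G$ by $(x,S)\mapsto(x+\alpha,A(x)S)$. It is constant if $A(\cdot)$ is a constant map. For $H(\cdot)\in C^\infty(\mathbb{T}^d,G)$, $\mathrm{Conj}_{H(\cdot)}(\alpha,A(\cdot))=(\alpha,H(\cdot+\alpha)A(\cdot)H^*(\cdot))$, where $H^*(x)=H(x)^{-1}$. Convergence of cocycles over $\alpha$ in $C^\infty$ means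 convergence of the maps $A(\cdot)$ in $C^\infty$. $\Phi=(\alpha,A(\cdot))$ is almost reducible if there exist $H_i(\cdot)\in C^\infty(\mathbb{T}^d,G)$ and constants $A_i\in G$ with $A_i^*H_i(\cdot+\alpha)A(\cdot)H_i^*(\cdot)\to\mathrm{Id}$ in $C^\infty$. Sobolev spaces: $G$ is regarded as a group of unitary matrices, and $H^s$ ($s\in\mathbb{R}$) convergence of $G$-valued maps on $\mathbb{T}^d$ means convergence of matrix entries in the usual Sobolev space $H^s(\mathbb{T}^d)$. Two cocycles $\Phi_1,\Phi_2$ over $\alpha$ are $H^s$ conjugate ($s\in\mathbb{R}$) if there is a sequence $H_i(\cdot)\in C^\infty(\mathbb{T}^d,G)$ such that $\mathrm{Conj}_{H_i(\cdot)}\Phi_1\to\Phi_2$ in $C^\infty$ and $H_i(\cdot)$ converges in $H^s$ to some $H(\cdot)\in H^s(\mathbb{T}^d,G)$. Rotation vector: if $a_\infty\in\mathfrak{t}$ and, for some $s\in\mathbb{R}$, $\Phi$ is $H^s$ conjugate to the constant cocycle $(\alpha,\exp(a_\infty))$, then $a_\infty$ is called a rotation vector for $\Phi$, written $a_\infty=\varrho(\Phi)$.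
   Formalization: A(·) is assumed to take values in the identity component of G (automatic for connected G); for disconnected G the claim fails otherwise, e.g. G={1,-1}, A=-1, and this condition is necessary for the conclusion. *)

theory Defs
  imports "HOL-Analysis.Analysis"
begin

text \<open>
  Maps on the torus \<open>\<real>\<^sup>d/\<int>\<^sup>d\<close> are \<open>\<int>\<^sup>d\<close>-periodic maps on \<open>real ^ 'd\<close>, with \<open>d = CARD('d)\<close>, and a point
  of the torus is given by a representative in \<open>real ^ 'd\<close>; no notion below depends on the choice
  of the representative.
\<close>

definition ivec :: "int ^ 'd \<Rightarrow> real ^ 'd" where
  "ivec k = (\<chi> j. of_int (k $ j))"

definition diophantine :: "real ^ 'd \<Rightarrow> bool" where
  "diophantine \<alpha> \<longleftrightarrow>
     (\<exists>\<gamma>>0. \<exists>\<tau>>0. \<forall>k. k \<noteq> 0 \<longrightarrow> infdist (\<alpha> \<bullet> ivec k) \<int> \<ge> inverse \<gamma> * norm (ivec k) powr (- \<tau>))"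


section \<open>Smooth maps and distributions on the torus\<close>

definition partial_deriv :: "'d \<Rightarrow> (real ^ 'd \<Rightarrow> 'b) \<Rightarrow> real ^ 'd \<Rightarrow> 'b :: real_normed_vector" where
  "partial_deriv j f = (\<lambda>x. frechet_derivative f (at x) (axis j 1))"

text \<open>Iterated partial derivatives; the multi-index is given as a list of coordinate directions.\<close>

definition partial_derivs ::
  "'d list \<Rightarrow> (real ^ 'd \<Rightarrow> 'b) \<Rightarrow> real ^ 'd \<Rightarrow> 'b :: real_normed_vector" where
  "partial_derivs js f = foldr partial_deriv js f"

definition Cinf_torus :: "(real ^ 'd \<Rightarrow> 'b :: real_normed_vector) set" where
  "Cinf_torus = {f. (\<forall>x k. f (x + ivec k) = f x) \<and>
                    (\<forall>js x. partial_derivs js f differentiable (at x))}"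

definition Cinf_tendsto ::
  "(nat \<Rightarrow> real ^ 'd \<Rightarrow> 'b) \<Rightarrow> (real ^ 'd \<Rightarrow> 'b :: real_normed_vector) \<Rightarrow> bool" where
  "Cinf_tendsto F f \<longleftrightarrow>
     (\<forall>js. uniform_limit UNIV (\<lambda>i. partial_derivs js (F i)) (partial_derivs js f) sequentially)"

text \<open>
  Distributions are functionals on all functions of which only the values on \<open>Cinf_torus\<close> matter.
  Since the space of smooth functions is metrizable, sequential continuity is continuity.
\<close>

definition distribution :: "((real ^ 'd \<Rightarrow> complex) \<Rightarrow> complex) \<Rightarrow> bool" where
  "distribution u \<longleftrightarrow>
     (\<forall>\<phi>\<in>Cinf_torus. \<forall>\<psi>\<in>Cinf_torus. u (\<lambda>x. \<phi> x + \<psi> x) = u \<phi> + u \<psi>) \<and>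
     (\<forall>c. \<forall>\<phi>\<in>Cinf_torus. u (\<lambda>x. c * \<phi> x) = c * u \<phi>) \<and>
     (\<forall>\<Phi> \<phi>. (\<forall>i. \<Phi> i \<in> Cinf_torus) \<and> \<phi> \<in> Cinf_torus \<and> Cinf_tendsto \<Phi> \<phi>
        \<longrightarrow> (\<lambda>i. u (\<Phi> i)) \<longlonglongrightarrow> u \<phi>)"

definition distr_of :: "(real ^ 'd \<Rightarrow> complex) \<Rightarrow> (real ^ 'd \<Rightarrow> complex) \<Rightarrow> complex" where
  "distr_of f = (\<lambda>\<phi>. integral (cbox 0 (\<chi> j. 1)) (\<lambda>x. f x * \<phi> x))"

definition fourier_coeff :: "((real ^ 'd \<Rightarrow> complex) \<Rightarrow> complex) \<Rightarrow> int ^ 'd \<Rightarrow> complex" where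
  "fourier_coeff u k = u (\<lambda>x. cis (- 2 * pi * (ivec k \<bullet> x)))"


section \<open>Sobolev spaces of real order\<close>

definition Hs_space :: "real \<Rightarrow> ((real ^ 'd \<Rightarrow> complex) \<Rightarrow> complex) set" where
  "Hs_space s = {u. distribution u \<and>
     (\<lambda>k. (1 + (norm (ivec k))\<^sup>2) powr s * (cmod (fourier_coeff u k))\<^sup>2) summable_on UNIV}"

definition Hs_norm :: "real \<Rightarrow> ((real ^ 'd \<Rightarrow> complex) \<Rightarrow> complex) \<Rightarrow> real" where
  "Hs_norm s u =
     sqrt (\<Sum>\<^sub>\<infinity>k. (1 + (norm (ivec k))\<^sup>2) powr s * (cmod (fourier_coeff u k))\<^sup>2)"

definition Hs_tendsto ::
  "real \<Rightarrow> (nat \<Rightarrow> (real ^ 'd \<Rightarrow> complex) \<Rightarrow> complex) \<Rightarrow>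
   ((real ^ 'd \<Rightarrow> complex) \<Rightarrow> complex) \<Rightarrow> bool" where
  "Hs_tendsto s U u \<longleftrightarrow>
     (\<forall>i. U i \<in> Hs_space s) \<and> u \<in> Hs_space s \<and>
     (\<lambda>i. Hs_norm s (\<lambda>\<phi>. U i \<phi> - u \<phi>)) \<longlonglongrightarrow> 0"


section \<open>Compact Lie groups of unitary matrices\<close>

definition mat_adjoint :: "complex ^ 'n ^ 'n \<Rightarrow> complex ^ 'n ^ 'n" where
  "mat_adjoint S = (\<chi> p q. cnj (S $ q $ p))"

definition unitary_matrices :: "(complex ^ 'n ^ 'n) set" where
  "unitary_matrices = {S. S ** mat_adjoint S = mat 1 \<and> mat_adjoint S ** S = mat 1}"

text \<open>
  Compact Lie groups are, up to isomorphism, the closed subgroups of the unitary groups (theorems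
  of Peter--Weyl and Cartan).
\<close>

definition compact_lie_group :: "(complex ^ 'n ^ 'n) set \<Rightarrow> bool" where
  "compact_lie_group G \<longleftrightarrow>
     G \<subseteq> unitary_matrices \<and> closed G \<and> mat 1 \<in> G \<and>
     (\<forall>S\<in>G. \<forall>R\<in>G. S ** R \<in> G) \<and> (\<forall>S\<in>G. matrix_inv S \<in> G)"

primrec mat_power :: "complex ^ 'n ^ 'n \<Rightarrow> nat \<Rightarrow> complex ^ 'n ^ 'n" where
  "mat_power S 0 = mat 1"
| "mat_power S (Suc m) = S ** mat_power S m"

text \<open>The class-based \<open>exp\<close> is not available here: \<open>*\<close> on \<open>vec\<close> is the componentwise product.\<close>

definition mat_exp :: "complex ^ 'n ^ 'n \<Rightarrow> complex ^ 'n ^ 'n" where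
  "mat_exp X = (\<Sum>m. (1 / fact m) *\<^sub>R mat_power X m)"

definition lie_algebra :: "(complex ^ 'n ^ 'n) set \<Rightarrow> (complex ^ 'n ^ 'n) set" where
  "lie_algebra G = {X. \<forall>t::real. mat_exp (t *\<^sub>R X) \<in> G}"

definition lie_group_dim :: "(complex ^ 'n ^ 'n) set \<Rightarrow> nat" where
  "lie_group_dim G = dim (lie_algebra G)"

definition torus_in :: "(complex ^ 'n ^ 'n) set \<Rightarrow> (complex ^ 'n ^ 'n) set \<Rightarrow> bool" where
  "torus_in G T \<longleftrightarrow>
     T \<subseteq> G \<and> compact_lie_group T \<and> connected T \<and> (\<forall>S\<in>T. \<forall>R\<in>T. S ** R = R ** S)"

definition maximal_torus :: "(complex ^ 'n ^ 'n) set \<Rightarrow> (complex ^ 'n ^ 'n) set \<Rightarrow> bool" where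
  "maximal_torus G T \<longleftrightarrow>
     torus_in G T \<and> (\<forall>T'. torus_in G T' \<and> T \<subseteq> T' \<longrightarrow> T' = T)"

text \<open>
  A compact Lie group need not be connected here. Conjugacy of a cocycle to \<open>exp a\<close> with \<open>a\<close> in the
  Lie algebra of a torus forces the cocycle to take values in the identity component (consider
  \<open>A = - 1\<close> in \<open>G = {1, - 1}\<close>), a condition that always holds when \<open>G\<close> is connected.
\<close>

definition identity_component :: "(complex ^ 'n ^ 'n) set \<Rightarrow> (complex ^ 'n ^ 'n) set" where
  "identity_component G = connected_component_set G (mat 1)"

definition Cinf_maps :: "(complex ^ 'n ^ 'n) set \<Rightarrow> (real ^ 'd \<Rightarrow> complex ^ 'n ^ 'n) set" where
  "Cinf_maps G = {F \<in> Cinf_torus. \<forall>x. F x \<in> G}"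

definition Hs_map_tendsto ::
  "real \<Rightarrow> (nat \<Rightarrow> real ^ 'd \<Rightarrow> complex ^ 'n ^ 'n) \<Rightarrow>
   ('n \<Rightarrow> 'n \<Rightarrow> (real ^ 'd \<Rightarrow> complex) \<Rightarrow> complex) \<Rightarrow> bool" where
  "Hs_map_tendsto s F U \<longleftrightarrow>
     (\<forall>p q. Hs_tendsto s (\<lambda>i. distr_of (\<lambda>x. F i x $ p $ q)) (U p q))"

text \<open>
  The space of maps of class \<open>H\<^sup>s\<close> with values in \<open>G\<close>. For \<open>s < 0\<close> its elements are matrices of
  distributions, for which pointwise values make no sense; as usual, it is therefore taken to be
  the \<open>H\<^sup>s\<close>-closure of the smooth \<open>G\<close>-valued maps.
\<close>

definition Hs_maps ::
  "real \<Rightarrow> (complex ^ 'n ^ 'n) set \<Rightarrow>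
   ('n \<Rightarrow> 'n \<Rightarrow> (real ^ 'd \<Rightarrow> complex) \<Rightarrow> complex) set" where
  "Hs_maps s G = {U. \<exists>F. (\<forall>i. F i \<in> Cinf_maps G) \<and> Hs_map_tendsto s F U}"


section \<open>Quasi-periodic cocycles\<close>

type_synonym ('d, 'n) cocycle = "(real ^ 'd) \<times> (real ^ 'd \<Rightarrow> complex ^ 'n ^ 'n)"

definition cocycles :: "(complex ^ 'n ^ 'n) set \<Rightarrow> real ^ 'd \<Rightarrow> ('d::finite, 'n::finite) cocycle set" where
  "cocycles G \<alpha> = {\<alpha>} \<times> Cinf_maps G"

definition constant_cocycle :: "real ^ 'd \<Rightarrow> complex ^ 'n ^ 'n \<Rightarrow> ('d::finite, 'n::finite) cocycle" where
  "constant_cocycle \<alpha> S = (\<alpha>, \<lambda>_. S)"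

definition Conj ::
  "(real ^ 'd \<Rightarrow> complex ^ 'n ^ 'n) \<Rightarrow> ('d::finite, 'n::finite) cocycle \<Rightarrow> ('d, 'n) cocycle" where
  "Conj H = (\<lambda>(\<alpha>, A). (\<alpha>, \<lambda>x. H (x + \<alpha>) ** A x ** matrix_inv (H x)))"

definition cocycle_tendsto :: "(nat \<Rightarrow> ('d::finite, 'n::finite) cocycle) \<Rightarrow> ('d, 'n) cocycle \<Rightarrow> bool" where
  "cocycle_tendsto \<Psi> \<Phi> \<longleftrightarrow>
     (\<forall>i. fst (\<Psi> i) = fst \<Phi>) \<and> Cinf_tendsto (\<lambda>i. snd (\<Psi> i)) (snd \<Phi>)"

definition almost_reducible :: "(complex ^ 'n ^ 'n) set \<Rightarrow> ('d::finite, 'n::finite) cocycle \<Rightarrow> bool" where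
  "almost_reducible G = (\<lambda>(\<alpha>, A).
     \<exists>H S. (\<forall>i. H i \<in> Cinf_maps G) \<and> (\<forall>i. S i \<in> G) \<and>
       Cinf_tendsto (\<lambda>i x. matrix_inv (S i) ** H i (x + \<alpha>) ** A x ** matrix_inv (H i x))
                    (\<lambda>_. mat 1))"

definition Hs_conjugate ::
  "real \<Rightarrow> (complex ^ 'n ^ 'n) set \<Rightarrow> ('d::finite, 'n::finite) cocycle \<Rightarrow> ('d, 'n) cocycle \<Rightarrow> bool" where
  "Hs_conjugate s G \<Phi>1 \<Phi>2 \<longleftrightarrow>
     (\<exists>H U. (\<forall>i. H i \<in> Cinf_maps G) \<and> cocycle_tendsto (\<lambda>i. Conj (H i) \<Phi>1) \<Phi>2 \<and>
        U \<in> Hs_maps s G \<and> Hs_map_tendsto s H U)"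

text \<open>A cocycle may have several rotation vectors, so this is a relation.\<close>

definition rotation_vector ::
  "(complex ^ 'n ^ 'n) set \<Rightarrow> (complex ^ 'n ^ 'n) set \<Rightarrow> ('d::finite, 'n::finite) cocycle \<Rightarrow>
   complex ^ 'n ^ 'n \<Rightarrow> bool" where
  "rotation_vector G T \<Phi> a \<longleftrightarrow>
     a \<in> lie_algebra T \<and> (\<exists>s. Hs_conjugate s G \<Phi> (constant_cocycle (fst \<Phi>) (mat_exp a)))"

end

theory Submission
  imports Defs
begin

text \<open>
  If \<open>S\<^sub>i\<^sup>-\<^sup>1 H\<^sub>i(x + \<alpha>) A(x) H\<^sub>i(x)\<^sup>-\<^sup>1\<close> tends to the identity, then along a subsequence on which the
  constants converge to some \<open>S\<close>, the conjugates of the cocycle by \<open>H\<^sub>i\<close> tend to \<open>S\<close>, which lies in the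
  identity component. Hence \<open>P S P\<^sup>-\<^sup>1 = exp a\<close> for some \<open>P\<close> in the group and \<open>a\<close> in the Lie algebra of
  the maximal torus, and \<open>P H\<^sub>i\<close> conjugates the cocycle towards \<open>exp a\<close>. The entries of the unitary
  matrices \<open>P H\<^sub>i\<close> are bounded by 1, so their Fourier coefficients converge along a further
  subsequence, and because \<open>\<Sum>\<^sub>k (1 + |k|\<^sup>2)\<^sup>s < \<infinity>\<close> for \<open>s \<le> - d\<close>, this gives convergence in \<open>H\<^sup>s\<close>.

  The maximal torus theorem is obtained by maximizing \<open>g \<mapsto> \<langle>g M g\<^sup>-\<^sup>1, N\<rangle>\<close> over the group: at a maximum,
  \<open>g M g\<^sup>-\<^sup>1\<close> commutes with \<open>N\<close> when both are in the Lie algebra, and also when \<open>M\<close> and \<open>N\<close> are close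
  elements of the group.
\<close>

section \<open>Matrices\<close>

lemma norm_sq_matrix:
  "(norm (A :: complex ^ 'n ^ 'm))\<^sup>2 = (\<Sum>i\<in>UNIV. \<Sum>j\<in>UNIV. (cmod (A $ i $ j))\<^sup>2)"
  by (simp add: norm_vec_def L2_set_def sum_nonneg)

lemma norm_matrix_matrix_mult_le:
  fixes A :: "complex ^ 'n ^ 'm" and B :: "complex ^ 'k ^ 'n"
  shows "norm (A ** B) \<le> norm A * norm B"
proof -
  have entry: "(cmod ((A ** B) $ i $ j))\<^sup>2
      \<le> (\<Sum>k\<in>UNIV. (cmod (A $ i $ k))\<^sup>2) * (\<Sum>k\<in>UNIV. (cmod (B $ k $ j))\<^sup>2)" for i j
  proof -
    have "cmod ((A ** B) $ i $ j) \<le> (\<Sum>k\<in>UNIV. cmod (A $ i $ k) * cmod (B $ k $ j))"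
      unfolding matrix_matrix_mult_def by (simp add: norm_mult[symmetric] norm_sum)
    then have "(cmod ((A ** B) $ i $ j))\<^sup>2 \<le> (\<Sum>k\<in>UNIV. cmod (A $ i $ k) * cmod (B $ k $ j))\<^sup>2"
      by (intro power_mono) auto
    also have "\<dots> \<le> (\<Sum>k\<in>UNIV. (cmod (A $ i $ k))\<^sup>2) * (\<Sum>k\<in>UNIV. (cmod (B $ k $ j))\<^sup>2)"
      by (rule Cauchy_Schwarz_ineq_sum)
    finally show ?thesis .
  qed
  have "(norm (A ** B))\<^sup>2 \<le> (\<Sum>i\<in>UNIV. \<Sum>j\<in>UNIV.
      (\<Sum>k\<in>UNIV. (cmod (A $ i $ k))\<^sup>2) * (\<Sum>k\<in>UNIV. (cmod (B $ k $ j))\<^sup>2))"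
    unfolding norm_sq_matrix by (intro sum_mono entry)
  also have "\<dots> = (\<Sum>i\<in>UNIV. \<Sum>k\<in>UNIV. (cmod (A $ i $ k))\<^sup>2) *
      (\<Sum>j\<in>UNIV. \<Sum>k\<in>UNIV. (cmod (B $ k $ j))\<^sup>2)"
    by (rule sum_product[symmetric])
  also have "(\<Sum>j\<in>UNIV. \<Sum>k\<in>UNIV. (cmod (B $ k $ j))\<^sup>2) = (norm B)\<^sup>2"
    unfolding norm_sq_matrix by (rule sum.swap)
  also have "(\<Sum>i\<in>UNIV. \<Sum>k\<in>UNIV. (cmod (A $ i $ k))\<^sup>2) = (norm A)\<^sup>2"
    unfolding norm_sq_matrix ..
  finally have "(norm (A ** B))\<^sup>2 \<le> (norm A * norm B)\<^sup>2"
    by (simp only: power_mult_distrib)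
  then show ?thesis
    by (rule power2_le_imp_le) simp
qed

lemma bounded_bilinear_matrix_mult:
  "bounded_bilinear ((**) :: complex ^ 'n ^ 'm \<Rightarrow> complex ^ 'k ^ 'n \<Rightarrow> complex ^ 'k ^ 'm)"
proof
  fix A A' :: "complex ^ 'n ^ 'm" and B B' :: "complex ^ 'k ^ 'n" and r :: real
  show "(A + A') ** B = A ** B + A' ** B"
    by (simp add: vec_eq_iff matrix_matrix_mult_def sum.distrib distrib_right)
  show "A ** (B + B') = A ** B + A ** B'"
    by (rule matrix_add_ldistrib)
  show "(r *\<^sub>R A) ** B = r *\<^sub>R (A ** B)"
    by (simp add: vec_eq_iff matrix_matrix_mult_def scaleR_sum_right)
  show "A ** (r *\<^sub>R B) = r *\<^sub>R (A ** B)"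
    by (simp add: vec_eq_iff matrix_matrix_mult_def scaleR_sum_right)
  show "\<exists>K. \<forall>(A :: complex ^ 'n ^ 'm) (B :: complex ^ 'k ^ 'n). norm (A ** B) \<le> norm A * norm B * K"
    by (intro exI[of _ 1]) (simp add: norm_matrix_matrix_mult_le)
qed

interpretation matrix_mult: bounded_bilinear
  "(**) :: complex ^ 'n ^ 'm \<Rightarrow> complex ^ 'k ^ 'n \<Rightarrow> complex ^ 'k ^ 'm"
  by (rule bounded_bilinear_matrix_mult)

lemmas matrix_mult_simps = matrix_mult.add_left matrix_mult.add_right matrix_mult.diff_left
  matrix_mult.diff_right matrix_mult.minus_left matrix_mult.minus_right
  matrix_mult.scaleR_left matrix_mult.scaleR_right

lemma mat_adjoint_simps [simp]:
  "mat_adjoint (mat_adjoint A) = A"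
  "mat_adjoint (mat 1) = mat 1"
  "mat_adjoint (A ** B) = mat_adjoint B ** mat_adjoint A"
  "mat_adjoint (A + B) = mat_adjoint A + mat_adjoint B"
  "mat_adjoint (A - B) = mat_adjoint A - mat_adjoint B"
  "mat_adjoint (- A) = - mat_adjoint A"
  "mat_adjoint (r *\<^sub>R A) = r *\<^sub>R mat_adjoint A"
  by (simp_all add: vec_eq_iff mat_adjoint_def matrix_matrix_mult_def mat_def mult.commute)

lemma norm_mat_adjoint [simp]: "norm (mat_adjoint A) = norm A"
proof -
  have "(norm (mat_adjoint A))\<^sup>2 = (norm A)\<^sup>2"
    unfolding norm_sq_matrix mat_adjoint_def by simp (rule sum.swap)
  then show ?thesis by simp
qed

lemma bounded_linear_mat_adjoint: "bounded_linear mat_adjoint"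
  by (rule bounded_linear_intro[where K = 1]) auto

lemmas tendsto_mat_adjoint [tendsto_intros] =
  bounded_linear.tendsto[OF bounded_linear_mat_adjoint]

lemma inner_matrix_eq:
  "inner (A :: complex ^ 'n ^ 'm) B = Re (\<Sum>i\<in>UNIV. \<Sum>j\<in>UNIV. A $ i $ j * cnj (B $ i $ j))"
  by (simp add: inner_vec_def inner_complex_def)

lemma inner_matrix_mult_left:
  fixes A B C :: "complex ^ 'n ^ 'n"
  shows "inner (A ** B) C = inner B (mat_adjoint A ** C)"
proof -
  have "(\<Sum>i\<in>UNIV. \<Sum>j\<in>UNIV. (A ** B) $ i $ j * cnj (C $ i $ j)) =
      (\<Sum>i\<in>UNIV. \<Sum>j\<in>UNIV. \<Sum>k\<in>UNIV. A $ i $ k * B $ k $ j * cnj (C $ i $ j))"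
    by (simp add: matrix_matrix_mult_def sum_distrib_right)
  also have "\<dots> = (\<Sum>i\<in>UNIV. \<Sum>k\<in>UNIV. \<Sum>j\<in>UNIV. A $ i $ k * B $ k $ j * cnj (C $ i $ j))"
    by (intro sum.cong refl sum.swap)
  also have "\<dots> = (\<Sum>k\<in>UNIV. \<Sum>i\<in>UNIV. \<Sum>j\<in>UNIV. A $ i $ k * B $ k $ j * cnj (C $ i $ j))"
    by (rule sum.swap)
  also have "\<dots> = (\<Sum>k\<in>UNIV. \<Sum>j\<in>UNIV. \<Sum>i\<in>UNIV. A $ i $ k * B $ k $ j * cnj (C $ i $ j))"
    by (intro sum.cong refl sum.swap)
  also have "\<dots> = (\<Sum>k\<in>UNIV. \<Sum>j\<in>UNIV. B $ k $ j * cnj ((mat_adjoint A ** C) $ k $ j))"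
    by (simp add: matrix_matrix_mult_def mat_adjoint_def sum_distrib_left mult.assoc mult.left_commute)
  finally show ?thesis by (simp only: inner_matrix_eq)
qed

lemma inner_mat_adjoint:
  "inner (mat_adjoint A) (mat_adjoint B) = inner A B"
  using dot_norm[of "mat_adjoint A" "mat_adjoint B"] dot_norm[of A B]
  by (metis mat_adjoint_simps(4) norm_mat_adjoint)

lemma inner_matrix_mult_right:
  fixes A B C :: "complex ^ 'n ^ 'n"
  shows "inner (A ** B) C = inner A (C ** mat_adjoint B)"
  using inner_mat_adjoint[of "A ** B" C] inner_mat_adjoint[of A "C ** mat_adjoint B"]
  by (simp add: inner_matrix_mult_left)

lemma mat_adjoint_unitary:
  assumes "U \<in> unitary_matrices"
  shows "U ** mat_adjoint U = mat 1" "mat_adjoint U ** U = mat 1" "mat_adjoint U \<in> unitary_matrices"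
  using assms by (auto simp: unitary_matrices_def)

lemma matrix_inv_unitary:
  assumes "U \<in> unitary_matrices"
  shows "matrix_inv U = mat_adjoint U"
proof -
  note U = mat_adjoint_unitary[OF assms]
  then have "U ** matrix_inv U = mat 1 \<and> matrix_inv U ** U = mat 1"
    using someI[of "\<lambda>V. U ** V = mat 1 \<and> V ** U = mat 1" "mat_adjoint U"]
    unfolding matrix_inv_def by simp
  then show ?thesis
    by (metis U(2) matrix_mul_assoc matrix_mul_lid matrix_mul_rid)
qed

lemma unitary_cancel [simp]:
  assumes "U \<in> unitary_matrices"
  shows "U ** mat_adjoint U = mat 1" "mat_adjoint U ** U = mat 1"
    "A ** U ** mat_adjoint U = A" "A ** mat_adjoint U ** U = A"
  using mat_adjoint_unitary[OF assms]
  by (simp_all add: matrix_mul_assoc[symmetric])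

lemma inner_unitary_left:
  "U \<in> unitary_matrices \<Longrightarrow> inner (U ** A) (U ** B) = inner A B" for A :: "complex ^ 'n ^ 'n"
  by (simp add: inner_matrix_mult_left matrix_mul_assoc)

lemma inner_unitary_right:
  "U \<in> unitary_matrices \<Longrightarrow> inner (A ** U) (B ** U) = inner A B" for A :: "complex ^ 'n ^ 'n"
  by (simp add: inner_matrix_mult_right)

lemma norm_unitary_mult [simp]:
  fixes A :: "complex ^ 'n ^ 'n"
  assumes "U \<in> unitary_matrices"
  shows "norm (U ** A) = norm A" "norm (A ** U) = norm A"
  by (simp_all add: norm_eq_sqrt_inner inner_unitary_left inner_unitary_right assms)

lemma unitary_mult [simp]:
  assumes "U \<in> unitary_matrices" "V \<in> unitary_matrices"
  shows "U ** V \<in> unitary_matrices"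
  using assms unfolding unitary_matrices_def
  by simp (metis matrix_mul_assoc matrix_mul_rid)

lemma norm_unitary_eq: "U \<in> unitary_matrices \<Longrightarrow> norm U = norm (mat 1 :: complex ^ 'n ^ 'n)"
  for U :: "complex ^ 'n ^ 'n"
  using norm_unitary_mult(1)[of U "mat 1"] by simp

lemma unitary_entry_le_1:
  assumes "U \<in> unitary_matrices"
  shows "cmod (U $ p $ q) \<le> 1"
proof -
  have "(\<Sum>k\<in>UNIV. U $ p $ k * cnj (U $ p $ k)) = 1"
    using arg_cong[OF mat_adjoint_unitary(1)[OF assms], of "\<lambda>M. M $ p $ p"]
    by (simp add: matrix_matrix_mult_def mat_adjoint_def mat_def)
  then have "(\<Sum>k\<in>UNIV. (cmod (U $ p $ k))\<^sup>2) = 1"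
    unfolding complex_norm_square[symmetric] of_real_sum[symmetric] by (simp only: of_real_eq_1_iff)
  moreover have "(cmod (U $ p $ q))\<^sup>2 \<le> (\<Sum>k\<in>UNIV. (cmod (U $ p $ k))\<^sup>2)"
    by (rule member_le_sum) auto
  ultimately show ?thesis
    using abs_square_le_1[of "cmod (U $ p $ q)"] by simp
qed


section \<open>The matrix exponential\<close>

lemma mat_power_commute:
  fixes X Y :: "complex ^ 'n ^ 'n"
  assumes "X ** Y = Y ** X"
  shows "mat_power X m ** Y = Y ** mat_power X m"
  by (induction m) (simp, metis assms mat_power.simps(2) matrix_mul_assoc)

lemma norm_mat_power_le:
  fixes X :: "complex ^ 'n ^ 'n"
  shows "norm (mat_power X m) \<le> norm (mat 1 :: complex ^ 'n ^ 'n) * norm X ^ m"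
proof (induction m)
  case (Suc m)
  have "norm (mat_power X (Suc m)) \<le> norm X * norm (mat_power X m)"
    by (simp add: norm_matrix_matrix_mult_le)
  also have "\<dots> \<le> norm X * (norm (mat 1 :: complex ^ 'n ^ 'n) * norm X ^ m)"
    using Suc by (intro mult_left_mono) auto
  finally show ?case by (simp add: algebra_simps)
qed simp

definition mat_exp_term :: "complex ^ 'n ^ 'n \<Rightarrow> nat \<Rightarrow> complex ^ 'n ^ 'n" where
  "mat_exp_term X m = (1 / fact m) *\<^sub>R mat_power X m"

lemma mat_exp_eq: "mat_exp X = (\<Sum>m. mat_exp_term X m)"
  by (simp add: mat_exp_def mat_exp_term_def)

lemma norm_mat_exp_term_le:
  fixes X :: "complex ^ 'n ^ 'n"
  shows "norm (mat_exp_term X m) \<le> norm (mat 1 :: complex ^ 'n ^ 'n) * (norm X ^ m /\<^sub>R fact m)"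
  using norm_mat_power_le[of X m] by (simp add: mat_exp_term_def divide_simps)

lemma summable_norm_mat_exp_term: "summable (\<lambda>m. norm (mat_exp_term X m))"
  by (rule summable_comparison_test'[OF summable_mult[OF summable_exp_generic]])
    (use norm_mat_exp_term_le in simp)

lemma summable_mat_exp_term: "summable (mat_exp_term X)"
  by (rule summable_norm_cancel[OF summable_norm_mat_exp_term])

lemma mat_exp_0 [simp]: "mat_exp (0 :: complex ^ 'n ^ 'n) = mat 1"
proof -
  have "mat_exp_term (0 :: complex ^ 'n ^ 'n) = (\<lambda>m. if m = 0 then mat 1 else 0)"
  proof
    fix m show "mat_exp_term (0 :: complex ^ 'n ^ 'n) m = (if m = 0 then mat 1 else 0)"
      by (cases m) (auto simp: mat_exp_term_def matrix_mult.zero_left)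
  qed
  then show ?thesis
    unfolding mat_exp_eq using sums_single[of 0 "\<lambda>_. mat 1 :: complex ^ 'n ^ 'n"]
    by (simp add: sums_iff)
qed

lemma mat_exp_term_add:
  fixes X Y :: "complex ^ 'n ^ 'n"
  assumes comm: "X ** Y = Y ** X"
  shows "mat_exp_term (X + Y) n = (\<Sum>i\<le>n. mat_exp_term X i ** mat_exp_term Y (n - i))"
proof (induction n)
  case 0
  show ?case by (simp add: mat_exp_term_def)
next
  case (Suc n)
  let ?T = "mat_exp_term"
  let ?f = "\<lambda>i. ?T X i ** ?T Y (Suc n - i)"
  have step: "Z ** ?T Z m = real (Suc m) *\<^sub>R ?T Z (Suc m)" for Z :: "complex ^ 'n ^ 'n" and m
    by (simp add: mat_exp_term_def matrix_mult.scaleR_right field_simps del: of_nat_Suc)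
  have "?T X i ** Y = Y ** ?T X i" for i
    by (simp add: mat_exp_term_def matrix_mult_simps mat_power_commute[OF comm])
  then have stepY: "Y ** (?T X i ** ?T Y (n - i)) = real (Suc n - i) *\<^sub>R ?f i" if "i \<le> n" for i
    using that step[of Y "n - i"]
    by (metis Suc_diff_le matrix_mul_assoc matrix_mult.scaleR_right)
  have stepX: "X ** (?T X i ** ?T Y (n - i)) = real (Suc i) *\<^sub>R ?f (Suc i)" for i
    using step[of X i] by (simp add: matrix_mul_assoc matrix_mult_simps)
  have "real (Suc n) *\<^sub>R ?T (X + Y) (Suc n) = (X + Y) ** (\<Sum>i\<le>n. ?T X i ** ?T Y (n - i))"
    using Suc step[of "X + Y" n] by simp
  also have "\<dots> = (\<Sum>i\<le>n. real (Suc i) *\<^sub>R ?f (Suc i)) + (\<Sum>i\<le>n. real (Suc n - i) *\<^sub>R ?f i)"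
    by (simp add: matrix_mult.add_left matrix_mult.sum_right stepX stepY sum.distrib del: of_nat_Suc)
  also have "(\<Sum>i\<le>n. real (Suc i) *\<^sub>R ?f (Suc i)) = (\<Sum>i\<le>Suc n. real i *\<^sub>R ?f i)"
    by (simp add: sum.atMost_Suc_shift del: sum.atMost_Suc)
  also have "(\<Sum>i\<le>n. real (Suc n - i) *\<^sub>R ?f i) = (\<Sum>i\<le>Suc n. real (Suc n - i) *\<^sub>R ?f i)"
    by simp
  also have "(\<Sum>i\<le>Suc n. real i *\<^sub>R ?f i) + (\<Sum>i\<le>Suc n. real (Suc n - i) *\<^sub>R ?f i)
      = (\<Sum>i\<le>Suc n. real (Suc n) *\<^sub>R ?f i)"
    unfolding sum.distrib[symmetric]
    by (intro sum.cong refl) (simp add: scaleR_add_left[symmetric] of_nat_diff)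
  also have "\<dots> = real (Suc n) *\<^sub>R (\<Sum>i\<le>Suc n. ?f i)"
    by (simp only: scaleR_right.sum)
  finally show ?case
    by (simp del: sum.atMost_Suc of_nat_Suc)
qed

lemma
  fixes X :: "complex ^ 'n ^ 'n"
  shows mat_exp_nth: "mat_exp X $ i $ j = (\<Sum>m. mat_exp_term X m $ i $ j)"
    and summable_mat_exp_nth: "summable (\<lambda>m. cmod (mat_exp_term X m $ i $ j))"
proof -
  have "bounded_linear (\<lambda>M :: complex ^ 'n ^ 'n. M $ i $ j)"
    by (rule bounded_linear_compose[OF bounded_linear_vec_nth bounded_linear_vec_nth])
  from bounded_linear.suminf[OF this summable_mat_exp_term[of X]]
  show "mat_exp X $ i $ j = (\<Sum>m. mat_exp_term X m $ i $ j)"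
    by (simp add: mat_exp_eq)
  have "cmod (mat_exp_term X m $ i $ j) \<le> norm (mat_exp_term X m)" for m
    by (rule order.trans[OF Finite_Cartesian_Product.norm_nth_le Finite_Cartesian_Product.norm_nth_le])
  then show "summable (\<lambda>m. cmod (mat_exp_term X m $ i $ j))"
    by (intro summable_comparison_test'[OF summable_norm_mat_exp_term[of X], of 0]) simp
qed

lemma mat_exp_add:
  fixes X Y :: "complex ^ 'n ^ 'n"
  assumes "X ** Y = Y ** X"
  shows "mat_exp (X + Y) = mat_exp X ** mat_exp Y"
proof -
  have "(\<lambda>m. mat_exp_term (X + Y) m $ i $ j) sums ((mat_exp X ** mat_exp Y) $ i $ j)" for i j
  proof -
    have "(\<lambda>m. \<Sum>k\<in>UNIV. \<Sum>l\<le>m. mat_exp_term X l $ i $ k * mat_exp_term Y (m - l) $ k $ j)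
        sums (\<Sum>k\<in>UNIV. mat_exp X $ i $ k * mat_exp Y $ k $ j)"
      unfolding mat_exp_nth
      by (intro sums_sum Cauchy_product_sums summable_mat_exp_nth)
    then show ?thesis
      unfolding mat_exp_term_add[OF assms]
      by (simp add: matrix_matrix_mult_def) (subst sum.swap, assumption)
  qed
  then show ?thesis
    by (simp add: vec_eq_iff mat_exp_nth sums_iff)
qed

lemma mat_exp_scaleR_add: "mat_exp ((s + t) *\<^sub>R X) = mat_exp (s *\<^sub>R X) ** mat_exp (t *\<^sub>R X)"
  by (simp add: scaleR_add_left mat_exp_add matrix_mult_simps)

lemma mat_exp_of_nat_scaleR: "mat_exp (real m *\<^sub>R X) = mat_power (mat_exp X) m"
proof (induction m)
  case (Suc m)
  show ?case
    using mat_exp_scaleR_add[of 1 "real m" X] Suc by simp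
qed simp

lemma mat_exp_minus: "mat_exp X ** mat_exp (- X) = mat 1" "mat_exp (- X) ** mat_exp X = mat 1"
  using mat_exp_add[of X "- X"] mat_exp_add[of "- X" X] by (simp_all add: matrix_mult_simps)

lemma mat_exp_bounded_linear:
  assumes "bounded_linear f" "\<And>m. f (mat_power X m) = mat_power (f X) m"
  shows "mat_exp (f X) = f (mat_exp X)"
proof -
  interpret f: bounded_linear f by fact
  have "f (mat_exp X) = (\<Sum>m. f (mat_exp_term X m))"
    unfolding mat_exp_eq by (rule f.suminf[OF summable_mat_exp_term])
  then show ?thesis
    by (simp add: mat_exp_eq mat_exp_term_def f.scaleR assms(2))
qed

lemma mat_exp_adjoint: "mat_exp (mat_adjoint X) = mat_adjoint (mat_exp X)"
proof (rule mat_exp_bounded_linear[OF bounded_linear_mat_adjoint])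
  show "mat_adjoint (mat_power X m) = mat_power (mat_adjoint X) m" for m
    by (induction m) (simp_all add: mat_power_commute)
qed

lemma mat_exp_conj:
  fixes U X :: "complex ^ 'n ^ 'n"
  assumes "U \<in> unitary_matrices"
  shows "mat_exp (U ** X ** mat_adjoint U) = U ** mat_exp X ** mat_adjoint U"
proof (rule mat_exp_bounded_linear[where f = "\<lambda>X. U ** X ** mat_adjoint U"])
  show "bounded_linear (\<lambda>X. U ** X ** mat_adjoint U)"
    by (intro bounded_linear_compose[OF matrix_mult.bounded_linear_left
          matrix_mult.bounded_linear_right])
  show "U ** mat_power X m ** mat_adjoint U = mat_power (U ** X ** mat_adjoint U) m" for m
  proof (induction m)
    case (Suc m)
    have "mat_power (U ** X ** mat_adjoint U) (Suc m)
        = U ** X ** (mat_adjoint U ** U) ** mat_power X m ** mat_adjoint U"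
      by (simp add: Suc[symmetric] matrix_mul_assoc)
    then show ?case using assms by (simp add: matrix_mul_assoc)
  qed (simp add: assms)
qed

lemma mat_exp_skew_unitary:
  assumes "mat_adjoint X = - X"
  shows "mat_exp X \<in> unitary_matrices"
  using mat_exp_minus[of X]
  by (simp only: unitary_matrices_def mem_Collect_eq mat_exp_adjoint[symmetric] assms simp_thms)

lemma mat_exp_commute:
  fixes X Y :: "complex ^ 'n ^ 'n"
  assumes "X ** Y = Y ** X"
  shows "mat_exp X ** Y = Y ** mat_exp X"
proof -
  have "mat_exp X ** Y = (\<Sum>m. mat_exp_term X m ** Y)"
    unfolding mat_exp_eq
    by (rule bounded_linear.suminf[OF matrix_mult.bounded_linear_left summable_mat_exp_term])
  also have "\<dots> = (\<Sum>m. Y ** mat_exp_term X m)"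
    by (simp add: mat_exp_term_def matrix_mult_simps mat_power_commute[OF assms])
  also have "\<dots> = Y ** mat_exp X"
    unfolding mat_exp_eq
    by (rule bounded_linear.suminf[OF matrix_mult.bounded_linear_right summable_mat_exp_term,
          symmetric])
  finally show ?thesis .
qed

lemma norm_mat_power_diff_le:
  fixes X Y :: "complex ^ 'n ^ 'n"
  assumes "norm X \<le> r" "norm Y \<le> r"
  shows "norm (mat_power X (Suc m) - mat_power Y (Suc m)) \<le> real (Suc m) * r ^ m * norm (X - Y)"
proof (induction m)
  case (Suc m)
  have r: "0 \<le> r" using assms(1) norm_ge_zero order.trans by blast
  have pw: "norm (mat_power Y (Suc m)) \<le> r ^ Suc m"
  proof (induction m)
    case (Suc m)
    have "norm (mat_power Y (Suc (Suc m))) \<le> norm Y * norm (mat_power Y (Suc m))"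
      unfolding mat_power.simps(2)[of Y "Suc m"] by (rule norm_matrix_matrix_mult_le)
    also have "\<dots> \<le> r * r ^ Suc m" using Suc assms r by (intro mult_mono) auto
    finally show ?case by simp
  qed (use assms in simp)
  have "mat_power X (Suc (Suc m)) - mat_power Y (Suc (Suc m))
      = X ** (mat_power X (Suc m) - mat_power Y (Suc m)) + (X - Y) ** mat_power Y (Suc m)"
    by (simp add: matrix_mult_simps)
  also have "norm \<dots> \<le> norm X * norm (mat_power X (Suc m) - mat_power Y (Suc m))
      + norm (X - Y) * norm (mat_power Y (Suc m))"
    by (intro norm_triangle_le add_mono norm_matrix_matrix_mult_le)
  also have "\<dots> \<le> r * (real (Suc m) * r ^ m * norm (X - Y)) + norm (X - Y) * r ^ Suc m"
    using assms r by (intro add_mono mult_mono Suc pw) auto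
  also have "\<dots> = real (Suc (Suc m)) * r ^ Suc m * norm (X - Y)"
    by (simp add: algebra_simps)
  finally show ?case .
qed simp

lemma norm_mat_exp_diff_le:
  fixes X Y :: "complex ^ 'n ^ 'n"
  assumes "norm X \<le> r" "norm Y \<le> r"
  shows "norm (mat_exp X - mat_exp Y - (X - Y)) \<le> (exp r - 1) * norm (X - Y)"
proof -
  let ?D = "\<lambda>m. mat_exp_term X m - mat_exp_term Y m"
  have sD: "summable ?D" by (intro summable_diff summable_mat_exp_term)
  have bound: "norm (?D (Suc m)) \<le> r ^ m /\<^sub>R fact m * norm (X - Y)" for m
  proof -
    have "?D (Suc m) = (1 / fact (Suc m)) *\<^sub>R (mat_power X (Suc m) - mat_power Y (Suc m))"
      unfolding mat_exp_term_def scaleR_diff_right ..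
    then have "norm (?D (Suc m)) = norm (mat_power X (Suc m) - mat_power Y (Suc m)) / fact (Suc m)"
      by (simp del: mat_power.simps fact_Suc)
    also have "\<dots> \<le> real (Suc m) * r ^ m * norm (X - Y) / fact (Suc m)"
      by (intro divide_right_mono norm_mat_power_diff_le assms) simp
    also have "\<dots> = r ^ m /\<^sub>R fact m * norm (X - Y)"
      by (simp add: divide_inverse del: of_nat_Suc)
    finally show ?thesis .
  qed
  have e: "(\<lambda>m. r ^ m /\<^sub>R fact m * norm (X - Y)) sums (exp r * norm (X - Y))"
    by (intro sums_mult2 exp_converges)
  have e1: "(\<lambda>m. r ^ Suc m /\<^sub>R fact (Suc m) * norm (X - Y)) sums ((exp r - 1) * norm (X - Y))"
    using e by (subst sums_Suc_iff) (simp add: algebra_simps)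
  have "mat_exp X - mat_exp Y = (\<Sum>m. ?D m)"
    unfolding mat_exp_eq by (rule suminf_diff[OF summable_mat_exp_term summable_mat_exp_term])
  also have "\<dots> = (\<Sum>m. ?D (Suc (Suc m))) + ?D 0 + ?D 1"
    using suminf_split_initial_segment[OF sD, of 2] by (simp add: numeral_2_eq_2 lessThan_Suc)
  finally have "mat_exp X - mat_exp Y - (X - Y) = (\<Sum>m. ?D (Suc (Suc m)))"
    by (simp add: mat_exp_term_def)
  also have "norm \<dots> \<le> (\<Sum>m. r ^ Suc m /\<^sub>R fact (Suc m) * norm (X - Y))"
  proof (rule norm_suminf_le)
    fix m show "norm (?D (Suc (Suc m))) \<le> r ^ Suc m /\<^sub>R fact (Suc m) * norm (X - Y)"
      by (rule bound)
  next
    show "summable (\<lambda>m. r ^ Suc m /\<^sub>R fact (Suc m) * norm (X - Y))"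
      using e1 by (simp only: sums_iff)
  qed
  also have "\<dots> = (exp r - 1) * norm (X - Y)"
    using e1 by (simp only: sums_iff)
  finally show ?thesis .
qed

section \<open>Compact Lie groups and their Lie algebras\<close>

lemma norm_mat_exp_diff_le':
  fixes X Y :: "complex ^ 'n ^ 'n"
  assumes "norm X \<le> r" "norm Y \<le> r"
  shows "norm (mat_exp X - mat_exp Y) \<le> exp r * norm (X - Y)"
  using norm_mat_exp_diff_le[OF assms] norm_triangle_sub[of "mat_exp X - mat_exp Y" "X - Y"]
  by (simp add: algebra_simps)

lemma tendsto_mat_exp [tendsto_intros]:
  fixes f :: "'a \<Rightarrow> complex ^ 'n ^ 'n"
  assumes f: "(f \<longlongrightarrow> X) F"
  shows "((\<lambda>x. mat_exp (f x)) \<longlongrightarrow> mat_exp X) F"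
proof (rule Lim_transform2)
  have "\<forall>\<^sub>F x in F. norm (f x) \<le> norm X + 1"
    using order_tendstoD(2)[OF tendsto_norm[OF f], of "norm X + 1"]
    by (auto elim: eventually_mono)
  then have "\<forall>\<^sub>F x in F. norm (mat_exp X - mat_exp (f x)) \<le> exp (norm X + 1) * norm (X - f x)"
    by eventually_elim (rule norm_mat_exp_diff_le', auto)
  moreover have "((\<lambda>x. exp (norm X + 1) * norm (X - f x)) \<longlongrightarrow> 0) F"
    using tendsto_mult[OF tendsto_const tendsto_norm[OF tendsto_diff[OF tendsto_const f]],
        of "exp (norm X + 1)" X] by simp
  ultimately show "((\<lambda>x. mat_exp X - mat_exp (f x)) \<longlongrightarrow> 0) F"
    by (rule Lim_null_comparison)
qed (rule tendsto_const)

lemma continuous_on_mat_exp [continuous_intros]: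
  "continuous_on S f \<Longrightarrow> continuous_on S (\<lambda>x. mat_exp (f x :: complex ^ 'n ^ 'n))"
  unfolding continuous_on_def by (auto intro: tendsto_mat_exp)

lemma tendsto_zero_of_scaled:
  fixes X :: "'a \<Rightarrow> 'b :: real_normed_vector"
  assumes c: "filterlim c at_top F" and X: "((\<lambda>n. c n *\<^sub>R X n) \<longlongrightarrow> Z) F"
  shows "(X \<longlongrightarrow> 0) F"
proof -
  have "((\<lambda>n. inverse (c n) *\<^sub>R (c n *\<^sub>R X n)) \<longlongrightarrow> 0 *\<^sub>R Z) F"
    by (intro tendsto_scaleR X tendsto_inverse_0_at_top c)
  moreover have "\<forall>\<^sub>F n in F. inverse (c n) *\<^sub>R (c n *\<^sub>R X n) = X n"
    using filterlim_at_top_dense[THEN iffD1, OF c, rule_format, of 0]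
    by eventually_elim auto
  ultimately show ?thesis
    by (simp add: tendsto_cong)
qed

lemma mat_exp_derivative:
  fixes X :: "'a \<Rightarrow> complex ^ 'n ^ 'n"
  assumes c: "filterlim c at_top F" and X: "((\<lambda>n. c n *\<^sub>R X n) \<longlongrightarrow> Z) F"
  shows "((\<lambda>n. c n *\<^sub>R (mat_exp (X n) - mat 1)) \<longlongrightarrow> Z) F"
proof (rule Lim_transform2[OF X])
  have "((\<lambda>n. (exp (norm (X n)) - 1) * norm (c n *\<^sub>R X n)) \<longlongrightarrow> (exp (norm (0::complex ^ 'n ^ 'n)) - 1) * norm Z) F"
    by (intro tendsto_intros X tendsto_zero_of_scaled[OF c X])
  then have lim: "((\<lambda>n. (exp (norm (X n)) - 1) * norm (c n *\<^sub>R X n)) \<longlongrightarrow> 0) F" by simp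
  have bound: "norm (c n *\<^sub>R X n - c n *\<^sub>R (mat_exp (X n) - mat 1))
      \<le> (exp (norm (X n)) - 1) * norm (c n *\<^sub>R X n)" for n
  proof -
    have "norm (c n *\<^sub>R X n - c n *\<^sub>R (mat_exp (X n) - mat 1))
        = \<bar>c n\<bar> * norm (mat_exp (X n) - mat_exp 0 - (X n - 0))"
      by (simp add: scaleR_diff_right[symmetric] norm_minus_commute)
    also have "\<dots> \<le> \<bar>c n\<bar> * ((exp (norm (X n)) - 1) * norm (X n - 0))"
      by (intro mult_left_mono norm_mat_exp_diff_le) auto
    finally show ?thesis by (simp add: algebra_simps)
  qed
  show "((\<lambda>n. c n *\<^sub>R X n - c n *\<^sub>R (mat_exp (X n) - mat 1)) \<longlongrightarrow> 0) F"
    by (rule Lim_null_comparison[OF always_eventually lim]) (use bound in blast)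
qed

lemma filterlim_real_Suc: "filterlim (\<lambda>n. real (Suc n)) at_top sequentially"
  by (rule filterlim_compose[OF filterlim_real_sequentially filterlim_Suc])

lemma mat_exp_derivative_seq:
  fixes X :: "complex ^ 'n ^ 'n"
  shows "(\<lambda>n. real (Suc n) *\<^sub>R (mat_exp ((1 / real (Suc n)) *\<^sub>R X) - mat 1)) \<longlonglongrightarrow> X"
  by (intro mat_exp_derivative filterlim_real_Suc) (simp del: of_nat_Suc)

lemma tendsto_mat_exp_seq:
  fixes X :: "complex ^ 'n ^ 'n"
  shows "(\<lambda>n. mat_exp ((1 / real (Suc n)) *\<^sub>R X)) \<longlonglongrightarrow> mat 1"
proof -
  have "(\<lambda>n. mat_exp ((1 / real (Suc n)) *\<^sub>R X)) \<longlonglongrightarrow> mat_exp (0 *\<^sub>R X)"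
    by (intro tendsto_intros LIMSEQ_Suc[OF lim_1_over_n])
  then show ?thesis by simp
qed

lemma conj_mat_exp_derivative:
  fixes X M :: "complex ^ 'n ^ 'n"
  shows "(\<lambda>n. real (Suc n) *\<^sub>R (mat_exp ((1 / real (Suc n)) *\<^sub>R X) ** M ** mat_exp (- ((1 / real (Suc n)) *\<^sub>R X)) - M))
      \<longlonglongrightarrow> X ** M - M ** X"
proof -
  let ?E = "\<lambda>n X. mat_exp ((1 / real (Suc n)) *\<^sub>R X) :: complex ^ 'n ^ 'n"
  let ?D = "\<lambda>n X. real (Suc n) *\<^sub>R (?E n X - mat 1)"
  have "(\<lambda>n. ?D n X ** M ** ?E n (- X) + M ** ?D n (- X)) \<longlonglongrightarrow> X ** M ** mat 1 + M ** (- X)"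
    by (intro tendsto_add matrix_mult.tendsto tendsto_const mat_exp_derivative_seq tendsto_mat_exp_seq)
  moreover have "?D n X ** M ** ?E n (- X) + M ** ?D n (- X)
      = real (Suc n) *\<^sub>R (?E n X ** M ** ?E n (- X) - M)" for n
    by (simp add: matrix_mult_simps scaleR_diff_right del: of_nat_Suc)
  ultimately show ?thesis
    by (simp add: matrix_mult_simps del: of_nat_Suc)
qed

lemma mat_1_unitary [simp]: "mat 1 \<in> unitary_matrices"
  by (simp add: unitary_matrices_def del: unitary_cancel)

lemma mat_power_unitary: "U \<in> unitary_matrices \<Longrightarrow> mat_power U m \<in> unitary_matrices"
  by (induction m) simp_all

lemma norm_unitary_mat_power_diff_le:
  fixes U V :: "complex ^ 'n ^ 'n"
  assumes "U \<in> unitary_matrices" "V \<in> unitary_matrices"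
  shows "norm (mat_power U m - mat_power V m) \<le> real m * norm (U - V)"
proof (induction m)
  case (Suc m)
  have "mat_power U (Suc m) - mat_power V (Suc m)
      = U ** (mat_power U m - mat_power V m) + (U - V) ** mat_power V m"
    by (simp add: matrix_mult_simps)
  also have "norm \<dots> \<le> norm (mat_power U m - mat_power V m) + norm (U - V)"
    using assms by (intro norm_triangle_le) (simp add: mat_power_unitary)
  finally show ?case using Suc by (simp add: algebra_simps)
qed simp

lemma
  fixes G :: "(complex ^ 'n ^ 'n) set"
  assumes "compact_lie_group G"
  shows lie_group_unitary: "S \<in> G \<Longrightarrow> S \<in> unitary_matrices"
    and lie_group_closed: "closed G"
    and lie_group_one: "mat 1 \<in> G"
    and lie_group_mult: "S \<in> G \<Longrightarrow> R \<in> G \<Longrightarrow> S ** R \<in> G"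
    and lie_group_adjoint: "S \<in> G \<Longrightarrow> mat_adjoint S \<in> G"
    and lie_group_mat_power: "S \<in> G \<Longrightarrow> mat_power S m \<in> G"
proof -
  show unit: "S \<in> unitary_matrices" if "S \<in> G" for S
    using assms that by (auto simp: compact_lie_group_def)
  show "closed G" and one: "mat 1 \<in> G" and mult: "\<And>S R. S \<in> G \<Longrightarrow> R \<in> G \<Longrightarrow> S ** R \<in> G"
    using assms by (auto simp: compact_lie_group_def)
  show "mat_adjoint S \<in> G" if "S \<in> G" for S
    using assms that unit[OF that] by (auto simp: compact_lie_group_def matrix_inv_unitary[symmetric])
  show "mat_power S m \<in> G" if "S \<in> G"
    by (induction m) (simp_all add: one mult that)
qed

lemma compact_lie_groupI:
  assumes "G \<subseteq> unitary_matrices" "closed G" "mat 1 \<in> G"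
    "\<And>S R. S \<in> G \<Longrightarrow> R \<in> G \<Longrightarrow> S ** R \<in> G" "\<And>S. S \<in> G \<Longrightarrow> mat_adjoint S \<in> G"
  shows "compact_lie_group G"
  using assms by (auto simp: compact_lie_group_def matrix_inv_unitary subset_iff)

lemma lie_group_compact:
  fixes G :: "(complex ^ 'n ^ 'n) set"
  assumes "compact_lie_group G"
  shows "compact G"
proof -
  have "bounded G"
    by (rule boundedI[of _ "norm (mat 1 :: complex ^ 'n ^ 'n)"])
      (simp add: norm_unitary_eq[OF lie_group_unitary[OF assms]])
  then show ?thesis
    using lie_group_closed[OF assms] by (simp add: compact_eq_bounded_closed)
qed

lemma lie_algebraD: "X \<in> lie_algebra G \<Longrightarrow> mat_exp (t *\<^sub>R X) \<in> G"
  by (simp add: lie_algebra_def)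

lemma lie_algebra_exp: "X \<in> lie_algebra G \<Longrightarrow> mat_exp X \<in> G"
  using lie_algebraD[of X G 1] by simp

lemma lie_algebra_mono: "G \<subseteq> K \<Longrightarrow> lie_algebra G \<subseteq> lie_algebra K"
  by (auto simp: lie_algebra_def)

lemma unitary_inverse_unique:
  fixes U V :: "complex ^ 'n ^ 'n"
  assumes "U \<in> unitary_matrices" "U ** V = mat 1"
  shows "V = mat_adjoint U"
proof -
  have "V = mat_adjoint U ** U ** V" using assms by simp
  also have "\<dots> = mat_adjoint U" using assms(2) by (simp add: matrix_mul_assoc[symmetric] del: unitary_cancel)
  finally show ?thesis .
qed

lemma lie_algebra_skew:
  fixes G :: "(complex ^ 'n ^ 'n) set"
  assumes G: "compact_lie_group G" and X: "X \<in> lie_algebra G"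
  shows "mat_adjoint X = - X"
proof -
  have "mat_exp ((1 / real (Suc n)) *\<^sub>R mat_adjoint X) = mat_exp ((1 / real (Suc n)) *\<^sub>R (- X))" for n
    using unitary_inverse_unique[OF lie_group_unitary[OF G lie_algebraD[OF X]] mat_exp_minus(1),
        of "1 / real (Suc n)"]
    by (simp add: mat_exp_adjoint[symmetric])
  then show ?thesis
    using mat_exp_derivative_seq[of "mat_adjoint X"] mat_exp_derivative_seq[of "- X"]
    by (simp only: LIMSEQ_unique)
qed

lemma lie_algebra_exp_adjoint:
  assumes "compact_lie_group G" "X \<in> lie_algebra G"
  shows "mat_adjoint (mat_exp X) = mat_exp (- X)"
  using lie_algebra_skew[OF assms] mat_exp_adjoint[of X] by simp

lemma lie_algebra_limit:
  fixes G :: "(complex ^ 'n ^ 'n) set" and c :: "nat \<Rightarrow> real"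
  assumes G: "compact_lie_group G" and g: "\<And>n. g n \<in> G"
    and c: "filterlim c at_top sequentially" and Z: "(\<lambda>n. c n *\<^sub>R (g n - mat 1)) \<longlonglongrightarrow> Z"
  shows "Z \<in> lie_algebra G"
proof -
  note gU = lie_group_unitary[OF G g]
  have "(\<lambda>n. g n - mat 1) \<longlonglongrightarrow> 0"
    by (rule tendsto_zero_of_scaled[OF c Z])
  then have g1: "g \<longlonglongrightarrow> mat 1"
    by (simp add: LIM_zero_iff)
  have "mat_adjoint (g n) ** (c n *\<^sub>R (g n - mat 1)) = - mat_adjoint (c n *\<^sub>R (g n - mat 1))" for n
    using gU[of n] by (simp add: matrix_mult_simps scaleR_minus_right[symmetric] del: scaleR_minus_right)
  moreover have "(\<lambda>n. mat_adjoint (g n) ** (c n *\<^sub>R (g n - mat 1))) \<longlonglongrightarrow> mat_adjoint (mat 1) ** Z"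
    by (intro tendsto_intros matrix_mult.tendsto g1 Z)
  ultimately have "(\<lambda>n. - mat_adjoint (c n *\<^sub>R (g n - mat 1))) \<longlonglongrightarrow> Z" by simp
  moreover have "(\<lambda>n. - mat_adjoint (c n *\<^sub>R (g n - mat 1))) \<longlonglongrightarrow> - mat_adjoint Z"
    by (intro tendsto_intros Z)
  ultimately have "Z = - mat_adjoint Z" by (rule LIMSEQ_unique)
  then have skew: "mat_adjoint Z = - Z" by (metis minus_minus)
  have pos: "mat_exp (t *\<^sub>R Z) \<in> G" if t: "t \<ge> 0" for t
  proof -
    define m where "m n = nat \<lfloor>t * c n\<rfloor>" for n
    have cpos: "\<forall>\<^sub>F n in sequentially. c n > 0"
      using c by (simp add: filterlim_at_top_dense)
    have m: "(\<lambda>n. real (m n) / c n) \<longlonglongrightarrow> t"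
    proof (rule Lim_transform2[OF tendsto_const])
      have "\<forall>\<^sub>F n in sequentially. norm (t - real (m n) / c n) \<le> inverse (c n)"
        using cpos
      proof eventually_elim
        case (elim n)
        have "\<bar>t * c n - real (m n)\<bar> \<le> 1"
          unfolding m_def using elim t by (simp add: of_nat_nat) linarith
        then have "\<bar>t * c n - real (m n)\<bar> / c n \<le> 1 / c n"
          using elim by (intro divide_right_mono) auto
        moreover have "\<bar>t * c n - real (m n)\<bar> / c n = \<bar>t - real (m n) / c n\<bar>"
          using elim by (simp add: abs_if field_simps)
        ultimately show ?case by (simp add: inverse_eq_divide)
      qed
      then show "(\<lambda>n. t - real (m n) / c n) \<longlonglongrightarrow> 0"
        by (rule Lim_null_comparison) (rule tendsto_inverse_0_at_top[OF c])
    qed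
    have eZ: "(\<lambda>n. c n *\<^sub>R (mat_exp (inverse (c n) *\<^sub>R Z) - mat 1)) \<longlonglongrightarrow> Z"
    proof (rule mat_exp_derivative[OF c])
      have "\<forall>\<^sub>F n in sequentially. Z = c n *\<^sub>R (inverse (c n) *\<^sub>R Z)"
        using cpos by eventually_elim auto
      then show "(\<lambda>n. c n *\<^sub>R (inverse (c n) *\<^sub>R Z)) \<longlonglongrightarrow> Z"
        by (rule Lim_transform_eventually[OF tendsto_const])
    qed
    have "(\<lambda>n. mat_power (g n) (m n)) \<longlonglongrightarrow> mat_exp (t *\<^sub>R Z)"
    proof (rule Lim_transform2)
      show "(\<lambda>n. mat_exp ((real (m n) / c n) *\<^sub>R Z)) \<longlonglongrightarrow> mat_exp (t *\<^sub>R Z)"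
        by (intro tendsto_intros m)
      let ?b = "\<lambda>n. real (m n) / c n * norm (c n *\<^sub>R (g n - mat 1)
          - c n *\<^sub>R (mat_exp (inverse (c n) *\<^sub>R Z) - mat 1))"
      have "?b \<longlonglongrightarrow> t * norm (Z - Z)"
        by (intro tendsto_intros m Z eZ)
      then have b: "?b \<longlonglongrightarrow> 0" by simp
      have "\<forall>\<^sub>F n in sequentially.
          norm (mat_exp ((real (m n) / c n) *\<^sub>R Z) - mat_power (g n) (m n)) \<le> ?b n"
        using cpos
      proof eventually_elim
        case (elim n)
        let ?V = "mat_exp (inverse (c n) *\<^sub>R Z)"
        have "mat_exp ((real (m n) / c n) *\<^sub>R Z) = mat_power ?V (m n)"
          by (simp add: mat_exp_of_nat_scaleR[symmetric] divide_inverse)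
        then have le: "norm (mat_exp ((real (m n) / c n) *\<^sub>R Z) - mat_power (g n) (m n))
            \<le> real (m n) * norm (g n - ?V)"
          using norm_unitary_mat_power_diff_le[OF gU[of n] mat_exp_skew_unitary[of "inverse (c n) *\<^sub>R Z"]]
          by (simp add: skew norm_minus_commute)
        have "c n *\<^sub>R (g n - mat 1) - c n *\<^sub>R (?V - mat 1) = c n *\<^sub>R (g n - ?V)"
          by (simp add: scaleR_diff_right)
        then have "?b n = real (m n) / c n * (\<bar>c n\<bar> * norm (g n - ?V))"
          by (simp only: norm_scaleR)
        also have "\<dots> = real (m n) * norm (g n - ?V)"
          using elim by simp
        finally show ?case using le by (simp only:)
      qed
      then show "(\<lambda>n. mat_exp ((real (m n) / c n) *\<^sub>R Z) - mat_power (g n) (m n)) \<longlonglongrightarrow> 0"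
        by (rule Lim_null_comparison[OF _ b])
    qed
    then show ?thesis
      by (rule closed_sequentially[OF lie_group_closed[OF G] lie_group_mat_power[OF G g]])
  qed
  have "mat_exp (t *\<^sub>R Z) \<in> G" if "t < 0" for t
  proof -
    have "mat_exp (t *\<^sub>R Z) = mat_adjoint (mat_exp ((- t) *\<^sub>R Z))"
      by (simp add: mat_exp_adjoint[symmetric] skew)
    then show ?thesis
      using lie_group_adjoint[OF G pos[of "- t"]] that by simp
  qed
  with pos show ?thesis
    unfolding lie_algebra_def using not_le by blast
qed

lemma lie_algebra_subspace:
  fixes G :: "(complex ^ 'n ^ 'n) set"
  assumes G: "compact_lie_group G"
  shows "subspace (lie_algebra G)"
proof (rule subspaceI)
  show "0 \<in> lie_algebra G"
    by (simp add: lie_algebra_def lie_group_one[OF G])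
  show "c *\<^sub>R X \<in> lie_algebra G" if "X \<in> lie_algebra G" for c X
    using that by (auto simp: lie_algebra_def)
  show "X + Y \<in> lie_algebra G" if X: "X \<in> lie_algebra G" and Y: "Y \<in> lie_algebra G" for X Y
  proof (rule lie_algebra_limit[OF G _ filterlim_real_Suc])
    let ?E = "\<lambda>n X. mat_exp ((1 / real (Suc n)) *\<^sub>R X) :: complex ^ 'n ^ 'n"
    let ?D = "\<lambda>n X. real (Suc n) *\<^sub>R (?E n X - mat 1)"
    show "?E n X ** ?E n Y \<in> G" for n
      by (intro lie_group_mult[OF G] lie_algebraD X Y)
    have "(\<lambda>n. ?D n X ** ?E n Y + ?D n Y) \<longlonglongrightarrow> X ** mat 1 + Y"
      by (intro tendsto_add matrix_mult.tendsto mat_exp_derivative_seq tendsto_mat_exp_seq)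
    then show "(\<lambda>n. real (Suc n) *\<^sub>R (?E n X ** ?E n Y - mat 1)) \<longlonglongrightarrow> X + Y"
      by (simp add: matrix_mult_simps scaleR_diff_right del: of_nat_Suc)
  qed
qed

lemma lie_algebra_conj:
  fixes G :: "(complex ^ 'n ^ 'n) set"
  assumes G: "compact_lie_group G" and "S \<in> G" "X \<in> lie_algebra G"
  shows "S ** X ** mat_adjoint S \<in> lie_algebra G"
  unfolding lie_algebra_def
proof (intro CollectI allI)
  fix t
  have "mat_exp (t *\<^sub>R (S ** X ** mat_adjoint S)) = S ** mat_exp (t *\<^sub>R X) ** mat_adjoint S"
    using mat_exp_conj[OF lie_group_unitary[OF G \<open>S \<in> G\<close>], of "t *\<^sub>R X"]
    by (simp add: matrix_mult_simps)
  then show "mat_exp (t *\<^sub>R (S ** X ** mat_adjoint S)) \<in> G"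
    using assms by (simp add: lie_group_mult lie_group_adjoint lie_algebraD)
qed

lemma lie_algebra_bracket:
  fixes G :: "(complex ^ 'n ^ 'n) set"
  assumes G: "compact_lie_group G" and X: "X \<in> lie_algebra G" and Y: "Y \<in> lie_algebra G"
  shows "X ** Y - Y ** X \<in> lie_algebra G"
proof (rule closed_sequentially[OF closed_subspace[OF lie_algebra_subspace[OF G]] _
      conj_mat_exp_derivative[of X Y]])
  note sub = lie_algebra_subspace[OF G]
  fix n
  let ?X = "(1 / real (Suc n)) *\<^sub>R X"
  have "?X \<in> lie_algebra G" using X sub by (rule subspace_scale[rotated])
  then have "mat_exp ?X ** Y ** mat_exp (- ?X) \<in> lie_algebra G"
    using lie_algebra_conj[OF G lie_algebra_exp Y] lie_algebra_exp_adjoint[OF G] by metis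
  then show "real (Suc n) *\<^sub>R (mat_exp ?X ** Y ** mat_exp (- ?X) - Y) \<in> lie_algebra G"
    by (intro subspace_scale[OF sub] subspace_diff[OF sub] Y)
qed

lemma critical_conjugate:
  fixes G :: "(complex ^ 'n ^ 'n) set"
  assumes G: "compact_lie_group G"
  obtains S where "S \<in> G" "inner M N \<le> inner (S ** M ** mat_adjoint S) N"
    "\<And>Y. Y \<in> lie_algebra G \<Longrightarrow>
      inner (Y ** (S ** M ** mat_adjoint S) - S ** M ** mat_adjoint S ** Y) N = 0"
proof -
  have "continuous_on G (\<lambda>S. inner (S ** M ** mat_adjoint S) N)"
    by (intro continuous_on_inner continuous_on_const matrix_mult.continuous_on continuous_on_id
        bounded_linear.continuous_on[OF bounded_linear_mat_adjoint])
  then obtain S where S: "S \<in> G"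
    and max: "\<And>R. R \<in> G \<Longrightarrow> inner (R ** M ** mat_adjoint R) N \<le> inner (S ** M ** mat_adjoint S) N"
    using continuous_attains_sup[OF lie_group_compact[OF G]] lie_group_one[OF G] by blast
  define M' where "M' = S ** M ** mat_adjoint S"
  have le: "inner (Y ** M' - M' ** Y) N \<le> 0" if Y: "Y \<in> lie_algebra G" for Y
  proof (rule LIMSEQ_le_const2)
    let ?Y = "\<lambda>n. (1 / real (Suc n)) *\<^sub>R Y"
    let ?f = "\<lambda>n. inner (real (Suc n) *\<^sub>R (mat_exp (?Y n) ** M' ** mat_exp (- ?Y n) - M')) N"
    show "?f \<longlonglongrightarrow> inner (Y ** M' - M' ** Y) N"
      by (intro tendsto_inner conj_mat_exp_derivative tendsto_const)
    have "?f n \<le> 0" for n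
    proof -
      have Yn: "?Y n \<in> lie_algebra G"
        using Y lie_algebra_subspace[OF G] by (rule subspace_scale[rotated])
      let ?R = "mat_exp (?Y n) ** S"
      have "?R \<in> G" using lie_group_mult[OF G lie_algebra_exp[OF Yn] S] .
      from max[OF this] have "inner (mat_exp (?Y n) ** M' ** mat_exp (- ?Y n)) N \<le> inner M' N"
        using lie_algebra_exp_adjoint[OF G Yn] by (simp add: M'_def matrix_mul_assoc del: of_nat_Suc)
      then show ?thesis
        by (simp add: inner_diff_left mult_nonneg_nonpos del: of_nat_Suc)
    qed
    then show "\<exists>N. \<forall>n\<ge>N. ?f n \<le> 0" by blast
  qed
  have "inner (Y ** M' - M' ** Y) N = 0" if Y: "Y \<in> lie_algebra G" for Y
    using le[OF Y] le[of "- Y"] subspace_neg[OF lie_algebra_subspace[OF G] Y]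
    by (simp add: matrix_mult_simps inner_diff_left)
  moreover have "inner M N \<le> inner M' N"
    using max[OF lie_group_one[OF G]] by (simp add: M'_def)
  ultimately show ?thesis
    using that[OF S] by (simp add: M'_def)
qed

lemma exp_quarter_le: "exp (1 / 4 :: real) - 1 \<le> 1 / 2"
  using exp_bound[of "1 / 4 :: real"] by (simp add: power2_eq_square)

lemma norm_le_mat_exp_minus_one:
  fixes X :: "complex ^ 'n ^ 'n"
  assumes "norm X \<le> 1 / 4"
  shows "norm X \<le> 2 * norm (mat_exp X - mat 1)"
proof -
  have "norm (mat_exp X - mat_exp 0 - (X - 0)) \<le> (exp (1 / 4) - 1) * norm (X - 0)"
    by (rule norm_mat_exp_diff_le) (use assms in auto)
  also have "\<dots> \<le> 1 / 2 * norm (X - 0)"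
    by (intro mult_right_mono exp_quarter_le) auto
  finally show ?thesis
    using norm_triangle_sub[of X "mat_exp X - mat 1"] by (simp add: norm_minus_commute)
qed

text \<open>
  If \<open>g\<close> were not hit, let \<open>exp X\<close> be a closest point to \<open>g\<close> among the exponentials of small elements
  of the Lie algebra; the direction of \<open>exp (- X) g - 1\<close> is asymptotically in the Lie algebra, and
  moving \<open>X\<close> along it gets closer.
\<close>

lemma lie_group_exp_near_one:
  fixes G :: "(complex ^ 'n ^ 'n) set"
  assumes G: "compact_lie_group G" and "\<epsilon> > 0"
  obtains \<delta> where "\<delta> > 0" "\<And>g. g \<in> G \<Longrightarrow> norm (g - mat 1) < \<delta> \<Longrightarrow>
    \<exists>X\<in>lie_algebra G. norm X < \<epsilon> \<and> mat_exp X = g"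
proof -
  let ?P = "\<lambda>g. \<exists>X\<in>lie_algebra G. norm X < \<epsilon> \<and> mat_exp X = g"
  have "\<exists>\<delta>>0. \<forall>g. g \<in> G \<longrightarrow> norm (g - mat 1) < \<delta> \<longrightarrow> ?P g"
  proof (rule ccontr)
    assume "\<not> ?thesis"
    then have "\<forall>n. \<exists>g. g \<in> G \<and> norm (g - mat 1) < inverse (real (Suc n)) \<and> \<not> ?P g"
      using positive_imp_inverse_positive[OF of_nat_0_less_iff[THEN iffD2, OF zero_less_Suc]]
      by meson
    then obtain g where g: "\<And>n. g n \<in> G" and g1: "\<And>n. norm (g n - mat 1) < inverse (real (Suc n))"
      and nP: "\<And>n. \<not> ?P (g n)"
      by metis
    define e where "e = min (\<epsilon> / 2) (1 / 4)"
    have e: "e > 0" "e < \<epsilon>" "e \<le> 1 / 4" using \<open>\<epsilon> > 0\<close> by (auto simp: e_def)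
    let ?K = "lie_algebra G \<inter> cball 0 e"
    note sub = lie_algebra_subspace[OF G]
    have K: "compact ?K"
      by (intro closed_Int_compact closed_subspace sub compact_cball)
    have "0 \<in> ?K" using e subspace_0[OF sub] by auto
    have "\<exists>X\<in>?K. \<forall>Y\<in>?K. norm (g n - mat_exp X) \<le> norm (g n - mat_exp Y)" for n
      by (intro continuous_attains_inf K continuous_intros) (use \<open>0 \<in> ?K\<close> in auto)
    then obtain X where XK: "\<And>n. X n \<in> ?K"
      and min: "\<And>n Y. Y \<in> ?K \<Longrightarrow> norm (g n - mat_exp (X n)) \<le> norm (g n - mat_exp Y)"
      by metis
    have XL: "X n \<in> lie_algebra G" and Xe: "norm (X n) \<le> e" for n using XK[of n] by auto
    define s where "s n = norm (g n - mat_exp (X n))" for n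
    have spos: "s n > 0" for n
      using nP[of n] XL[of n] Xe[of n] e unfolding s_def by fastforce
    have g1lim: "(\<lambda>n. g n - mat 1) \<longlonglongrightarrow> 0"
      by (rule Lim_null_comparison[OF _ LIMSEQ_inverse_real_of_nat])
        (use g1 in \<open>auto intro!: always_eventually less_imp_le\<close>)
    have s0: "s \<longlonglongrightarrow> 0"
      by (rule Lim_null_comparison[OF _ tendsto_norm_zero[OF g1lim]])
        (use min[OF \<open>0 \<in> ?K\<close>] in \<open>simp add: s_def\<close>)
    have X0: "X \<longlonglongrightarrow> 0"
    proof (rule Lim_null_comparison)
      have "norm (X n) \<le> 2 * (s n + norm (g n - mat 1))" for n
      proof -
        have "norm (X n) \<le> 2 * norm (mat_exp (X n) - mat 1)"
          using Xe[of n] e by (intro norm_le_mat_exp_minus_one) auto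
        also have "norm (mat_exp (X n) - mat 1) \<le> s n + norm (g n - mat 1)"
          unfolding s_def
          using norm_triangle_ineq[of "mat_exp (X n) - g n" "g n - mat 1"]
          by (simp add: norm_minus_commute)
        finally show ?thesis by simp
      qed
      then show "\<forall>\<^sub>F n in sequentially. norm (X n) \<le> 2 * (s n + norm (g n - mat 1))" by simp
      have "(\<lambda>n. 2 * (s n + norm (g n - mat 1))) \<longlonglongrightarrow> 2 * (0 + norm (0 :: complex ^ 'n ^ 'n))"
        by (intro tendsto_intros s0 g1lim)
      then show "(\<lambda>n. 2 * (s n + norm (g n - mat 1))) \<longlonglongrightarrow> 0" by simp
    qed
    define h where "h n = mat_exp (- X n) ** g n" for n
    have hG: "h n \<in> G" for n
      unfolding h_def using lie_group_mult[OF G lie_algebra_exp g] subspace_neg[OF sub XL] by blast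
    have gh: "g n - mat_exp (X n) = mat_exp (X n) ** (h n - mat 1)" for n
      by (simp add: h_def matrix_mult_simps matrix_mul_assoc mat_exp_minus)
    have normh: "norm (h n - mat 1) = s n" for n
      unfolding s_def gh using lie_group_unitary[OF G lie_algebra_exp[OF XL]] by simp
    define Z where "Z n = inverse (s n) *\<^sub>R (h n - mat 1)" for n
    have "Z n \<in> sphere 0 1" for n
      using spos[of n] by (simp add: Z_def normh)
    then obtain Z0 r where Z0: "norm Z0 = 1" and r: "strict_mono r" and Zr: "(Z \<circ> r) \<longlonglongrightarrow> Z0"
      using compact_sphere[of "0 :: complex ^ 'n ^ 'n" 1] unfolding compact_def
      by (metis mem_sphere_0)
    have sr: "(\<lambda>n. s (r n)) \<longlonglongrightarrow> 0" and Xr: "(\<lambda>n. X (r n)) \<longlonglongrightarrow> 0"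
      using LIMSEQ_subseq_LIMSEQ[OF s0 r] LIMSEQ_subseq_LIMSEQ[OF X0 r] by (simp_all add: o_def)
    have "Z0 \<in> lie_algebra G"
    proof (rule lie_algebra_limit[OF G hG])
      show "filterlim (\<lambda>n. inverse (s (r n))) at_top sequentially"
        using sr spos by (intro filterlim_inverse_at_top) auto
      show "(\<lambda>n. inverse (s (r n)) *\<^sub>R (h (r n) - mat 1)) \<longlonglongrightarrow> Z0"
        using Zr by (simp add: Z_def o_def)
    qed
    then have YL: "X n + s n *\<^sub>R Z0 \<in> lie_algebra G" for n
      by (intro subspace_add[OF sub] subspace_scale[OF sub] XL)
    let ?b = "\<lambda>n. norm (mat_exp (X (r n)) ** Z (r n) - Z0) + (exp (norm (X (r n)) + s (r n)) - 1)"
    have "?b \<longlonglongrightarrow> norm (mat_exp 0 ** Z0 - Z0) + (exp (norm (0 :: complex ^ 'n ^ 'n) + 0) - 1)"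
      using Zr by (intro tendsto_intros matrix_mult.tendsto sr Xr) (simp add: o_def)
    then have b0: "?b \<longlonglongrightarrow> 0" by simp
    have "(\<lambda>n. X (r n) + s (r n) *\<^sub>R Z0) \<longlonglongrightarrow> 0 + 0 *\<^sub>R Z0"
      by (intro tendsto_intros sr Xr)
    then have "\<forall>\<^sub>F n in sequentially. norm (X (r n) + s (r n) *\<^sub>R Z0) < e"
      using order_tendstoD(2)[OF tendsto_norm_zero \<open>e > 0\<close>] by simp
    then have "\<forall>\<^sub>F n in sequentially. 1 \<le> ?b n"
    proof eventually_elim
      case (elim n)
      let ?x = "X (r n)" and ?s = "s (r n)"
      let ?y = "?x + ?s *\<^sub>R Z0"
      have "?s \<le> norm (g (r n) - mat_exp ?y)"
        unfolding s_def by (rule min) (use elim YL in \<open>auto simp: s_def\<close>)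
      also have "g (r n) - mat_exp ?y =
          ?s *\<^sub>R (mat_exp ?x ** Z (r n) - Z0) - (mat_exp ?y - mat_exp ?x - (?y - ?x))"
        using gh[of "r n"] spos[of "r n"]
        by (simp add: Z_def matrix_mult_simps scaleR_diff_right algebra_simps)
      also have "norm \<dots> \<le> ?s * norm (mat_exp ?x ** Z (r n) - Z0) + (exp (norm ?x + ?s) - 1) * norm (?y - ?x)"
      proof (rule order.trans[OF norm_triangle_ineq4 add_mono])
        show "norm (?s *\<^sub>R (mat_exp ?x ** Z (r n) - Z0)) \<le> ?s * norm (mat_exp ?x ** Z (r n) - Z0)"
          using spos[of "r n"] by simp
        show "norm (mat_exp ?y - mat_exp ?x - (?y - ?x)) \<le> (exp (norm ?x + ?s) - 1) * norm (?y - ?x)"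
          using spos[of "r n"] norm_triangle_ineq[of ?x "?s *\<^sub>R Z0"] Z0
          by (intro norm_mat_exp_diff_le) auto
      qed
      finally have "?s * 1 \<le> ?s * ?b n"
        using Z0 spos[of "r n"] by (simp add: algebra_simps)
      then show ?case using spos[of "r n"] by (simp only: mult_le_cancel_left_pos)
    qed
    then have "1 \<le> (0 :: real)"
      by (rule tendsto_lowerbound[OF b0]) simp
    then show False by simp
  qed
  then show ?thesis using that by blast
qed

section \<open>Conjugation into a maximal torus\<close>

lemma connected_eq_of_uniform_nbhd:
  fixes C :: "'a :: metric_space set"
  assumes "connected C" "E \<subseteq> C" "E \<noteq> {}" "\<delta> > 0"
    and nbhd: "\<And>x y. x \<in> E \<Longrightarrow> y \<in> C \<Longrightarrow> dist x y < \<delta> \<Longrightarrow> y \<in> E"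
  shows "E = C"
proof -
  have "openin (top_of_set C) E"
    unfolding openin_euclidean_subtopology_iff
    using assms(2,4) nbhd by (metis dist_commute)
  moreover have "openin (top_of_set C) (C - E)"
    unfolding openin_euclidean_subtopology_iff
    using assms(4) nbhd by (metis Diff_iff Diff_subset)
  then have "closedin (top_of_set C) E"
    using assms(2) by (simp add: closedin_def)
  ultimately show ?thesis
    using assms(1,3) unfolding connected_clopen by blast
qed

lemma commute_of_mat_exp_commute:
  fixes X M :: "complex ^ 'n ^ 'n"
  assumes "\<And>t. mat_exp (t *\<^sub>R X) ** M = M ** mat_exp (t *\<^sub>R X)"
  shows "X ** M = M ** X"
proof -
  let ?D = "\<lambda>n. real (Suc n) *\<^sub>R (mat_exp ((1 / real (Suc n)) *\<^sub>R X) - mat 1)"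
  have "(\<lambda>n. ?D n ** M) \<longlonglongrightarrow> X ** M" "(\<lambda>n. M ** ?D n) \<longlonglongrightarrow> M ** X"
    by (intro matrix_mult.tendsto mat_exp_derivative_seq tendsto_const)+
  moreover have "?D n ** M = M ** ?D n" for n
    using assms[of "1 / real (Suc n)"] by (simp add: matrix_mult_simps del: of_nat_Suc)
  ultimately show ?thesis
    using LIMSEQ_unique by simp
qed

lemma torus_lie_algebra_commute:
  fixes T :: "(complex ^ 'n ^ 'n) set"
  assumes T: "torus_in G T" and X: "X \<in> lie_algebra T" and Y: "Y \<in> lie_algebra T"
  shows "X ** Y = Y ** X"
proof (rule commute_of_mat_exp_commute)
  fix t
  have commT: "S ** R = R ** S" if "S \<in> T" "R \<in> T" for S R
    using T that by (simp add: torus_in_def)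
  have "Y ** mat_exp (t *\<^sub>R X) = mat_exp (t *\<^sub>R X) ** Y"
    by (rule commute_of_mat_exp_commute, rule commT) (intro lie_algebraD X Y)+
  then show "mat_exp (t *\<^sub>R X) ** Y = Y ** mat_exp (t *\<^sub>R X)" ..
qed

lemma torus_exp_surj:
  fixes T :: "(complex ^ 'n ^ 'n) set"
  assumes T: "torus_in G T"
  shows "mat_exp ` lie_algebra T = T"
proof -
  have LT: "compact_lie_group T" and "connected T"
    using T by (auto simp: torus_in_def)
  note sub = lie_algebra_subspace[OF LT]
  obtain \<delta> where "\<delta> > 0" and \<delta>: "\<And>g. g \<in> T \<Longrightarrow> norm (g - mat 1) < \<delta> \<Longrightarrow>
      \<exists>X\<in>lie_algebra T. norm X < 1 \<and> mat_exp X = g"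
    using lie_group_exp_near_one[OF LT zero_less_one] by metis
  show ?thesis
  proof (rule connected_eq_of_uniform_nbhd[OF \<open>connected T\<close> _ _ \<open>\<delta> > 0\<close>])
    show "mat_exp ` lie_algebra T \<subseteq> T" "mat_exp ` lie_algebra T \<noteq> {}"
      using lie_algebra_exp subspace_0[OF sub] by auto
    fix S R assume "S \<in> mat_exp ` lie_algebra T" and R: "R \<in> T" and SR: "dist S R < \<delta>"
    then obtain X where X: "X \<in> lie_algebra T" and S: "S = mat_exp X" by auto
    have ST: "S \<in> T" unfolding S by (rule lie_algebra_exp[OF X])
    note SU = lie_group_unitary[OF LT ST]
    have "norm (mat_adjoint S ** R - mat 1) = norm (mat_adjoint S ** (R - S))"
      using SU by (simp add: matrix_mult_simps)
    also have "\<dots> = norm (R - S)"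
      using mat_adjoint_unitary(3)[OF SU] by simp
    finally have "norm (mat_adjoint S ** R - mat 1) < \<delta>"
      using SR by (simp add: dist_norm norm_minus_commute)
    then obtain Y where Y: "Y \<in> lie_algebra T" and "mat_exp Y = mat_adjoint S ** R"
      using \<delta>[OF lie_group_mult[OF LT lie_group_adjoint[OF LT ST] R]] by auto
    then have "mat_exp (X + Y) = R"
      using torus_lie_algebra_commute[OF T X Y] SU by (simp add: mat_exp_add S[symmetric] matrix_mul_assoc)
    then show "R \<in> mat_exp ` lie_algebra T"
      using subspace_add[OF sub X Y] by blast
  qed
qed

lemma closed_commutant: "closed {S :: complex ^ 'n ^ 'n. S ** M = M ** S}"
  by (intro closed_Collect_eq matrix_mult.continuous_on continuous_on_id continuous_on_const)

lemma centralizer_lie_group: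
  fixes G :: "(complex ^ 'n ^ 'n) set"
  assumes G: "compact_lie_group G"
  shows "compact_lie_group {S \<in> G. S ** M = M ** S}"
proof (rule compact_lie_groupI)
  show "{S \<in> G. S ** M = M ** S} \<subseteq> unitary_matrices"
    using lie_group_unitary[OF G] by auto
  have "{S \<in> G. S ** M = M ** S} = G \<inter> {S. S ** M = M ** S}" by auto
  then show "closed {S \<in> G. S ** M = M ** S}"
    using closed_Int[OF lie_group_closed[OF G] closed_commutant] by simp
  show "mat 1 \<in> {S \<in> G. S ** M = M ** S}"
    using lie_group_one[OF G] by simp
  fix S assume S: "S \<in> {S \<in> G. S ** M = M ** S}"
  then have SU: "S \<in> unitary_matrices" using lie_group_unitary[OF G] by blast
  have "mat_adjoint S ** M = mat_adjoint S ** (M ** S) ** mat_adjoint S"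
    using SU by (simp add: matrix_mul_assoc)
  also have "\<dots> = mat_adjoint S ** (S ** M) ** mat_adjoint S"
    using S by simp
  also have "\<dots> = M ** mat_adjoint S"
    using SU by (simp add: matrix_mul_assoc)
  finally show "mat_adjoint S \<in> {S \<in> G. S ** M = M ** S}"
    using S lie_group_adjoint[OF G] by simp
  fix R assume "R \<in> {S \<in> G. S ** M = M ** S}"
  then show "S ** R \<in> {S \<in> G. S ** M = M ** S}"
    using S lie_group_mult[OF G, of S R] by (metis (mono_tags, lifting) matrix_mul_assoc mem_Collect_eq)
qed

lemma lie_algebra_centralizer:
  fixes G :: "(complex ^ 'n ^ 'n) set"
  assumes "X \<in> lie_algebra G" "X ** M = M ** X"
  shows "X \<in> lie_algebra {S \<in> G. S ** M = M ** S}"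
  using assms unfolding lie_algebra_def
  by (auto intro!: mat_exp_commute simp: matrix_mult_simps)

lemma conjugate_commute_single:
  fixes G :: "(complex ^ 'n ^ 'n) set"
  assumes G: "compact_lie_group G" and X: "X \<in> lie_algebra G" and H: "H \<in> lie_algebra G"
  obtains S where "S \<in> G" "(S ** X ** mat_adjoint S) ** H = H ** (S ** X ** mat_adjoint S)"
proof -
  obtain S where S: "S \<in> G" and crit: "\<And>Y. Y \<in> lie_algebra G \<Longrightarrow>
      inner (Y ** (S ** X ** mat_adjoint S) - S ** X ** mat_adjoint S ** Y) H = 0"
    using critical_conjugate[OF G, of X H] by metis
  define M where "M = S ** X ** mat_adjoint S"
  have M: "M \<in> lie_algebra G" unfolding M_def by (rule lie_algebra_conj[OF G S X])
  define Y where "Y = M ** H - H ** M"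
  have "inner (Y ** M - M ** Y) H = 0"
    using crit[OF lie_algebra_bracket[OF G M H]] by (simp add: Y_def M_def)
  also have "inner (Y ** M - M ** Y) H = inner Y (H ** mat_adjoint M) - inner Y (mat_adjoint M ** H)"
    by (simp add: inner_diff_left inner_matrix_mult_left[of M] inner_matrix_mult_right[of Y])
  also have "\<dots> = inner Y Y"
    using lie_algebra_skew[OF G M] by (simp add: matrix_mult_simps Y_def inner_diff_right)
  finally show ?thesis
    using that[OF S] by (simp add: Y_def M_def)
qed

lemma conjugate_commute_finite:
  fixes G :: "(complex ^ 'n ^ 'n) set"
  assumes "finite B" "compact_lie_group G" "X \<in> lie_algebra G" "B \<subseteq> lie_algebra G"
    and "\<And>H K. H \<in> B \<Longrightarrow> K \<in> B \<Longrightarrow> H ** K = K ** H"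
  shows "\<exists>S\<in>G. \<forall>H\<in>B. (S ** X ** mat_adjoint S) ** H = H ** (S ** X ** mat_adjoint S)"
  using assms
proof (induction B arbitrary: G X rule: finite_induct)
  case empty
  then show ?case using lie_group_one by blast
next
  case (insert H B)
  note G = \<open>compact_lie_group G\<close>
  obtain S where S: "S \<in> G" and SH: "(S ** X ** mat_adjoint S) ** H = H ** (S ** X ** mat_adjoint S)"
    using conjugate_commute_single[OF G insert.prems(2), of H] insert.prems(3) by auto
  let ?X = "S ** X ** mat_adjoint S" and ?G = "{S \<in> G. S ** H = H ** S}"
  have "\<exists>R\<in>?G. \<forall>K\<in>B. (R ** ?X ** mat_adjoint R) ** K = K ** (R ** ?X ** mat_adjoint R)"
  proof (rule insert.IH)
    show "?X \<in> lie_algebra ?G"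
      using lie_algebra_centralizer[OF lie_algebra_conj[OF G S insert.prems(2)] SH] .
    show "B \<subseteq> lie_algebra ?G"
      using insert.prems(3,4) by (auto intro!: lie_algebra_centralizer)
    show "compact_lie_group ?G" by (rule centralizer_lie_group[OF G])
  qed (use insert.prems(4) in auto)
  then obtain R where R: "R \<in> ?G"
    and RB: "\<And>K. K \<in> B \<Longrightarrow> (R ** ?X ** mat_adjoint R) ** K = K ** (R ** ?X ** mat_adjoint R)"
    by blast
  have RU: "mat_adjoint R ** H = H ** mat_adjoint R"
    using lie_group_adjoint[OF centralizer_lie_group[OF G] R] by simp
  have "R ** ?X ** mat_adjoint R ** H = R ** (?X ** H) ** mat_adjoint R"
    by (simp add: matrix_mul_assoc[symmetric] RU)
  also have "\<dots> = (R ** H) ** ?X ** mat_adjoint R"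
    by (simp only: SH matrix_mul_assoc)
  also have "\<dots> = H ** (R ** ?X ** mat_adjoint R)"
    using R by (simp add: matrix_mul_assoc)
  finally have RH: "R ** ?X ** mat_adjoint R ** H = H ** (R ** ?X ** mat_adjoint R)" .
  have "(R ** S) ** X ** mat_adjoint (R ** S) = R ** ?X ** mat_adjoint R"
    by (simp add: matrix_mul_assoc)
  then show ?case
    using RH RB lie_group_mult[OF G, of R S] R S by (intro bexI[of _ "R ** S"]) auto
qed

lemma torus_in_closure:
  fixes G D :: "(complex ^ 'n ^ 'n) set"
  assumes G: "compact_lie_group G" and "D \<subseteq> G" "mat 1 \<in> D" "connected D"
    and mult: "\<And>S R. S \<in> D \<Longrightarrow> R \<in> D \<Longrightarrow> S ** R \<in> D"
    and adj: "\<And>S. S \<in> D \<Longrightarrow> mat_adjoint S \<in> D"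
    and comm: "\<And>S R. S \<in> D \<Longrightarrow> R \<in> D \<Longrightarrow> S ** R = R ** S"
  shows "torus_in G (closure D)"
proof -
  have clG: "closure D \<subseteq> G"
    by (intro closure_minimal assms lie_group_closed)
  have mult1: "S ** R \<in> closure D" if "S \<in> closure D" "R \<in> D" for S R
  proof -
    have "(\<lambda>S. S ** R) ` closure D \<subseteq> closure D"
      using mult[OF _ \<open>R \<in> D\<close>] closure_subset
      by (intro image_closure_subset matrix_mult.continuous_on continuous_on_id continuous_on_const)
        blast+
    then show ?thesis using that by blast
  qed
  have mult2: "S ** R \<in> closure D" if "S \<in> closure D" "R \<in> closure D" for S R
  proof -
    have "(\<lambda>R. S ** R) ` closure D \<subseteq> closure D"
      using mult1[OF \<open>S \<in> closure D\<close>]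
      by (intro image_closure_subset matrix_mult.continuous_on continuous_on_id continuous_on_const)
        blast+
    then show ?thesis using that by blast
  qed
  have adj1: "mat_adjoint S \<in> closure D" if "S \<in> closure D" for S
  proof -
    have "mat_adjoint ` closure D \<subseteq> closure D"
      using adj closure_subset
      by (intro image_closure_subset bounded_linear.continuous_on[OF bounded_linear_mat_adjoint]
          continuous_on_id) blast+
    then show ?thesis using that by blast
  qed
  have comm1: "S ** R = R ** S" if "S \<in> closure D" "R \<in> D" for S R
  proof -
    have "closure D \<subseteq> {S. S ** R = R ** S}"
      by (intro closure_minimal closed_commutant) (use comm that in auto)
    then show ?thesis using that by auto
  qed
  have comm2: "S ** R = R ** S" if "S \<in> closure D" "R \<in> closure D" for S R
  proof -
    have "closure D \<subseteq> {R. R ** S = S ** R}"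
      by (intro closure_minimal closed_commutant) (use comm1 that in auto)
    then show ?thesis using that by auto
  qed
  have "compact_lie_group (closure D)"
  proof (rule compact_lie_groupI)
    show "closure D \<subseteq> unitary_matrices"
      using clG lie_group_unitary[OF G] by blast
    show "mat 1 \<in> closure D"
      using \<open>mat 1 \<in> D\<close> closure_subset by blast
  qed (auto intro: mult2 adj1)
  then show ?thesis
    unfolding torus_in_def using clG connected_imp_connected_closure[OF \<open>connected D\<close>] comm2 by blast
qed

lemma lie_algebra_maximal_torus:
  fixes G T :: "(complex ^ 'n ^ 'n) set"
  assumes G: "compact_lie_group G" and T: "maximal_torus G T"
    and Y: "Y \<in> lie_algebra G" and comm: "\<And>S. S \<in> T \<Longrightarrow> Y ** S = S ** Y"
  shows "Y \<in> lie_algebra T"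
proof -
  have TG: "torus_in G T" and max: "\<And>T'. torus_in G T' \<Longrightarrow> T \<subseteq> T' \<Longrightarrow> T' = T"
    using T by (auto simp: maximal_torus_def)
  then have LT: "compact_lie_group T" and conT: "connected T" and "T \<subseteq> G"
    and commT: "\<And>S R. S \<in> T \<Longrightarrow> R \<in> T \<Longrightarrow> S ** R = R ** S"
    by (auto simp: torus_in_def)
  let ?e = "\<lambda>t. mat_exp (t *\<^sub>R Y)"
  have eS: "?e t ** S = S ** ?e t" if "S \<in> T" for S t
    using comm[OF that] by (intro mat_exp_commute) (simp add: matrix_mult_simps)
  have ee: "?e s ** ?e t = ?e (s + t)" for s t
    by (simp add: mat_exp_scaleR_add)
  define D where "D = (\<lambda>(S, t). S ** ?e t) ` (T \<times> UNIV)"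
  have DI: "S ** ?e t \<in> D" if "S \<in> T" for S t
    using that by (force simp: D_def)
  have DE: "\<exists>S t. S \<in> T \<and> M = S ** ?e t" if "M \<in> D" for M
    using that by (auto simp: D_def)
  have prod: "(S ** ?e s) ** (R ** ?e t) = (S ** R) ** ?e (s + t)" if "R \<in> T" for S R s t
  proof -
    have "(S ** ?e s) ** (R ** ?e t) = S ** (?e s ** R) ** ?e t" by (simp only: matrix_mul_assoc)
    also have "\<dots> = (S ** R) ** (?e s ** ?e t)" by (simp only: eS[OF that] matrix_mul_assoc)
    finally show ?thesis by (simp only: ee)
  qed
  have "torus_in G (closure D)"
  proof (rule torus_in_closure[OF G])
    show "D \<subseteq> G"
      using \<open>T \<subseteq> G\<close> lie_algebraD[OF Y] lie_group_mult[OF G] by (auto simp: D_def)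
    show "mat 1 \<in> D"
      using DI[OF lie_group_one[OF LT], of 0] by simp
    have "continuous_on (T \<times> UNIV) (\<lambda>p. fst p ** ?e (snd p))"
      by (intro matrix_mult.continuous_on continuous_intros)
    then show "connected D"
      unfolding D_def case_prod_unfold
      by (intro connected_continuous_image connected_Times conT connected_UNIV)
    fix M assume "M \<in> D"
    then obtain S s where S: "S \<in> T" and M: "M = S ** ?e s" using DE by blast
    have "mat_adjoint M = ?e (- s) ** mat_adjoint S"
      using lie_algebra_skew[OF G Y] by (simp add: M mat_exp_adjoint[symmetric])
    also have "\<dots> = mat_adjoint S ** ?e (- s)"
      by (rule eS[OF lie_group_adjoint[OF LT S]])
    finally show "mat_adjoint M \<in> D"
      by (simp only: DI[OF lie_group_adjoint[OF LT S]])
    fix N assume "N \<in> D"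
    then obtain R t where R: "R \<in> T" and N: "N = R ** ?e t" using DE by blast
    show "M ** N \<in> D"
      unfolding M N prod[OF R] by (rule DI[OF lie_group_mult[OF LT S R]])
    show "M ** N = N ** M"
      unfolding M N prod[OF R] prod[OF S] by (simp add: commT[OF S R] add.commute)
  qed
  moreover have "T \<subseteq> D"
    using DI[of _ 0] by auto
  ultimately have "closure D = T"
    using max closure_subset[of D] by blast
  then have "?e t \<in> T" for t
    using DI[OF lie_group_one[OF LT], of t] closure_subset[of D] by auto
  then show ?thesis by (simp add: lie_algebra_def)
qed

lemma lie_algebra_conjugate_into_torus:
  fixes G T :: "(complex ^ 'n ^ 'n) set"
  assumes G: "compact_lie_group G" and T: "maximal_torus G T" and X: "X \<in> lie_algebra G"
  obtains S where "S \<in> G" "S ** X ** mat_adjoint S \<in> lie_algebra T"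
proof -
  have TG: "torus_in G T"
    using T by (auto simp: maximal_torus_def)
  then have "T \<subseteq> G" by (auto simp: torus_in_def)
  obtain B where BT: "B \<subseteq> lie_algebra T" and "independent B" and TB: "lie_algebra T \<subseteq> span B"
    and "card B = dim (lie_algebra T)"
    by (rule basis_exists)
  have "finite B" using independent_bound[OF \<open>independent B\<close>] by simp
  have "\<exists>S\<in>G. \<forall>H\<in>B. (S ** X ** mat_adjoint S) ** H = H ** (S ** X ** mat_adjoint S)"
    using BT lie_algebra_mono[OF \<open>T \<subseteq> G\<close>] torus_lie_algebra_commute[OF TG]
    by (intro conjugate_commute_finite[OF \<open>finite B\<close> G X]) blast+
  then obtain S where S: "S \<in> G"
    and comm: "\<And>H. H \<in> B \<Longrightarrow> (S ** X ** mat_adjoint S) ** H = H ** (S ** X ** mat_adjoint S)"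
    by blast
  let ?Y = "S ** X ** mat_adjoint S"
  have "subspace {H. ?Y ** H = H ** ?Y}"
    by (rule subspaceI) (simp_all add: matrix_mult_simps matrix_mult.zero_left matrix_mult.zero_right)
  then have "span B \<subseteq> {H. ?Y ** H = H ** ?Y}"
    using comm by (intro span_minimal) auto
  then have commT: "?Y ** H = H ** ?Y" if "H \<in> lie_algebra T" for H
    using that TB by blast
  have "?Y \<in> lie_algebra T"
  proof (rule lie_algebra_maximal_torus[OF G T lie_algebra_conj[OF G S X]])
    fix R assume "R \<in> T"
    then obtain H where "H \<in> lie_algebra T" "R = mat_exp H"
      using torus_exp_surj[OF TG] by blast
    then show "?Y ** R = R ** ?Y"
      using mat_exp_commute[of H ?Y] commT by simp
  qed
  then show ?thesis using that[OF S] by blast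
qed

text \<open>
  Among the conjugates of an element close to \<open>t\<close> in the torus, a closest one to \<open>t\<close> is \<open>t exp X\<close> with
  \<open>X\<close> commuting with \<open>t\<close>; then \<open>X\<close> can be conjugated into the Lie algebra of the torus within the
  centralizer of \<open>t\<close>.
\<close>

lemma conjugate_into_torus_near:
  fixes G T :: "(complex ^ 'n ^ 'n) set"
  assumes G: "compact_lie_group G" and T: "maximal_torus G T"
  obtains \<delta> where "\<delta> > 0" "\<And>t g. t \<in> T \<Longrightarrow> g \<in> G \<Longrightarrow> norm (g - t) < \<delta> \<Longrightarrow>
    \<exists>S\<in>G. S ** g ** mat_adjoint S \<in> T"
proof -
  obtain \<delta> where "\<delta> > 0" and \<delta>: "\<And>g. g \<in> G \<Longrightarrow> norm (g - mat 1) < \<delta> \<Longrightarrow>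
      \<exists>X\<in>lie_algebra G. norm X < 1 / 4 \<and> mat_exp X = g"
    by (rule lie_group_exp_near_one[OF G, of "1 / 4"]) (auto simp: that)
  have TG: "torus_in G T"
    using T by (auto simp: maximal_torus_def)
  then have "T \<subseteq> G" and LT: "compact_lie_group T"
    and commT: "\<And>S R. S \<in> T \<Longrightarrow> R \<in> T \<Longrightarrow> S ** R = R ** S"
    by (auto simp: torus_in_def)
  have "\<exists>S\<in>G. S ** g ** mat_adjoint S \<in> T" if t: "t \<in> T" and g: "g \<in> G" and gt: "norm (g - t) < \<delta>" for t g
  proof -
    have tG: "t \<in> G" using t \<open>T \<subseteq> G\<close> by blast
    note tU = lie_group_unitary[OF G tG]
    note sub = lie_algebra_subspace[OF G]
    obtain S where S: "S \<in> G" and closer: "inner g t \<le> inner (S ** g ** mat_adjoint S) t"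
      and crit: "\<And>Y. Y \<in> lie_algebra G \<Longrightarrow>
        inner (Y ** (S ** g ** mat_adjoint S) - S ** g ** mat_adjoint S ** Y) t = 0"
      using critical_conjugate[OF G, of g t] by metis
    define g' where "g' = S ** g ** mat_adjoint S"
    have g'G: "g' \<in> G"
      unfolding g'_def by (intro lie_group_mult[OF G] lie_group_adjoint[OF G] S g)
    have "norm g' = norm g"
      using norm_unitary_eq lie_group_unitary[OF G] g g'G by metis
    then have "inner g' g' = inner g g"
      by (simp add: norm_eq_sqrt_inner)
    then have "(norm (g' - t))\<^sup>2 \<le> (norm (g - t))\<^sup>2"
      using closer
      by (simp add: power2_norm_eq_inner g'_def inner_diff_left inner_diff_right inner_commute)
    then have "norm (g' - t) < \<delta>"
      using gt by (meson norm_ge_zero order.strict_trans1 power2_le_imp_le)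
    moreover have "norm (mat_adjoint t ** g' - mat 1) = norm (g' - t)"
    proof -
      have "mat_adjoint t ** g' - mat 1 = mat_adjoint t ** (g' - t)"
        using tU by (simp add: matrix_mult_simps)
      then show ?thesis using mat_adjoint_unitary(3)[OF tU] by simp
    qed
    ultimately obtain X where X: "X \<in> lie_algebra G" and Xs: "norm X < 1 / 4"
      and eX: "mat_exp X = mat_adjoint t ** g'"
      using \<delta>[OF lie_group_mult[OF G lie_group_adjoint[OF G tG] g'G]] by auto
    have g'X: "g' = t ** mat_exp X"
      using tU by (simp add: eX matrix_mul_assoc)
    define Z where "Z = t ** X ** mat_adjoint t"
    have Z: "Z \<in> lie_algebra G" unfolding Z_def by (rule lie_algebra_conj[OF G tG X])
    have normZ: "norm Z = norm X"
      using tU mat_adjoint_unitary(3)[OF tU] by (simp add: Z_def)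
    have eZ: "mat_exp (- Z) = t ** mat_exp (- X) ** mat_adjoint t"
      using mat_exp_conj[OF tU, of "- X"] by (simp add: Z_def matrix_mult_simps)
    define Y where "Y = X - Z"
    have "inner (Y ** g' - g' ** Y) t = 0"
      using crit[of Y] subspace_diff[OF sub X Z] by (simp add: Y_def g'_def)
    also have "inner (Y ** g' - g' ** Y) t = inner Y (t ** mat_adjoint g' - mat_adjoint g' ** t)"
      by (simp add: inner_diff_left inner_diff_right inner_matrix_mult_left[of g'] inner_matrix_mult_right[of Y])
    also have "t ** mat_adjoint g' - mat_adjoint g' ** t = mat_exp (- Z) - mat_exp (- X)"
      using tU lie_algebra_exp_adjoint[OF G X] by (simp add: g'X eZ matrix_mul_assoc)
    finally have orth: "inner Y (mat_exp (- Z) - mat_exp (- X)) = 0" .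
    have "(norm Y)\<^sup>2 = inner Y (Y - (mat_exp (- Z) - mat_exp (- X)))"
      using orth by (simp add: inner_diff_right power2_norm_eq_inner)
    also have "\<dots> \<le> norm Y * norm (mat_exp (- Z) - mat_exp (- X) - (- Z - - X))"
      using norm_cauchy_schwarz[of Y "Y - (mat_exp (- Z) - mat_exp (- X))"]
      by (simp add: Y_def norm_minus_commute algebra_simps)
    also have "\<dots> \<le> norm Y * ((exp (1 / 4) - 1) * norm (- Z - - X))"
      using Xs normZ by (intro mult_left_mono norm_mat_exp_diff_le) auto
    also have "\<dots> \<le> norm Y * (1 / 2 * norm Y)"
      unfolding Y_def by (intro mult_left_mono mult_mono exp_quarter_le) auto
    finally have "norm Y * norm Y \<le> 0"
      by (simp add: power2_eq_square)
    then have "Y = 0" by (simp add: mult_le_0_iff)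
    then have "X ** t = Z ** t" by (simp add: Y_def)
    also have "\<dots> = t ** X" using tU by (simp add: Z_def)
    finally have Xt: "X ** t = t ** X" .
    let ?G = "{S \<in> G. S ** t = t ** S}"
    have "T \<subseteq> ?G" using \<open>T \<subseteq> G\<close> commT t by auto
    then have "maximal_torus ?G T"
      using T unfolding maximal_torus_def torus_in_def by blast
    then obtain R where R: "R \<in> ?G" and RX: "R ** X ** mat_adjoint R \<in> lie_algebra T"
      using lie_algebra_conjugate_into_torus[OF centralizer_lie_group[OF G]
          _ lie_algebra_centralizer[OF X Xt]] by blast
    have "R ** g' ** mat_adjoint R = (R ** t) ** mat_exp X ** mat_adjoint R"
      by (simp add: g'X matrix_mul_assoc)
    also have "\<dots> = t ** (R ** mat_exp X ** mat_adjoint R)"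
      using R by (simp add: matrix_mul_assoc)
    also have "R ** mat_exp X ** mat_adjoint R = mat_exp (R ** X ** mat_adjoint R)"
      using R lie_group_unitary[OF G, of R] by (simp add: mat_exp_conj)
    finally have "R ** g' ** mat_adjoint R \<in> T"
      using lie_group_mult[OF LT t lie_algebra_exp[OF RX]] by simp
    then have "(R ** S) ** g ** mat_adjoint (R ** S) \<in> T"
      by (simp add: g'_def matrix_mul_assoc)
    then show ?thesis
      using lie_group_mult[OF G, of R S] R S by blast
  qed
  then show ?thesis using that \<open>\<delta> > 0\<close> by blast
qed

lemma conjugate_into_maximal_torus:
  fixes G T :: "(complex ^ 'n ^ 'n) set"
  assumes G: "compact_lie_group G" and T: "maximal_torus G T" and g: "g \<in> identity_component G"
  obtains S where "S \<in> G" "S ** g ** mat_adjoint S \<in> T"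
proof -
  have TG: "torus_in G T"
    using T by (auto simp: maximal_torus_def)
  then have "T \<subseteq> G" and LT: "compact_lie_group T"
    by (auto simp: torus_in_def)
  obtain \<delta> where "\<delta> > 0" and \<delta>: "\<And>t g. t \<in> T \<Longrightarrow> g \<in> G \<Longrightarrow> norm (g - t) < \<delta> \<Longrightarrow>
      \<exists>S\<in>G. S ** g ** mat_adjoint S \<in> T"
    using conjugate_into_torus_near[OF G T] by blast
  let ?C = "identity_component G"
  define E where "E = {g \<in> ?C. \<exists>S\<in>G. S ** g ** mat_adjoint S \<in> T}"
  have CG: "?C \<subseteq> G"
    by (simp add: identity_component_def connected_component_subset)
  have "E = ?C"
  proof (rule connected_eq_of_uniform_nbhd[OF _ _ _ \<open>\<delta> > 0\<close>])
    show "connected ?C" "E \<subseteq> ?C"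
      by (auto simp: identity_component_def E_def)
    have "mat 1 \<in> E"
      using lie_group_one[OF G] lie_group_one[OF LT]
      by (auto simp: E_def identity_component_def intro: bexI[of _ "mat 1"])
    then show "E \<noteq> {}" by blast
    fix x y assume "x \<in> E" and y: "y \<in> ?C" and xy: "dist x y < \<delta>"
    then obtain S where S: "S \<in> G" and Sx: "S ** x ** mat_adjoint S \<in> T" by (auto simp: E_def)
    note SU = lie_group_unitary[OF G S]
    have "S ** y ** mat_adjoint S - S ** x ** mat_adjoint S = S ** (y - x) ** mat_adjoint S"
      by (simp add: matrix_mult_simps)
    then have "norm (S ** y ** mat_adjoint S - S ** x ** mat_adjoint S) = norm (y - x)"
      using SU mat_adjoint_unitary(3)[OF SU] by simp
    then have "norm (S ** y ** mat_adjoint S - S ** x ** mat_adjoint S) < \<delta>"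
      using xy by (simp add: dist_norm norm_minus_commute)
    moreover have "S ** y ** mat_adjoint S \<in> G"
      using y CG by (intro lie_group_mult[OF G] lie_group_adjoint[OF G] S) auto
    ultimately obtain R where R: "R \<in> G" and "R ** (S ** y ** mat_adjoint S) ** mat_adjoint R \<in> T"
      using \<delta>[OF Sx] by blast
    then have "(R ** S) ** y ** mat_adjoint (R ** S) \<in> T"
      by (simp add: matrix_mul_assoc)
    then show "y \<in> E"
      using y lie_group_mult[OF G R S] unfolding E_def by blast
  qed
  then show ?thesis using g that by (auto simp: E_def)
qed

section \<open>Smooth maps on the torus\<close>

definition smooth :: "(real ^ 'd \<Rightarrow> 'b :: real_normed_vector) \<Rightarrow> bool" where
  "smooth f \<longleftrightarrow> (\<forall>js x. partial_derivs js f differentiable (at x))"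

primrec diff_times :: "nat \<Rightarrow> (real ^ 'd \<Rightarrow> 'b :: real_normed_vector) \<Rightarrow> bool" where
  "diff_times 0 f \<longleftrightarrow> (\<forall>x. f differentiable (at x))"
| "diff_times (Suc n) f \<longleftrightarrow> (\<forall>x. f differentiable (at x)) \<and> (\<forall>j. diff_times n (partial_deriv j f))"

lemma Cinf_torus_iff: "f \<in> Cinf_torus \<longleftrightarrow> (\<forall>x k. f (x + ivec k) = f x) \<and> smooth f"
  by (simp add: Cinf_torus_def smooth_def)

lemma partial_derivs_simps [simp]:
  "partial_derivs [] f = f"
  "partial_derivs (j # js) f = partial_deriv j (partial_derivs js f)"
  by (simp_all add: partial_derivs_def)

lemma partial_derivs_snoc: "partial_derivs (js @ [j]) f = partial_derivs js (partial_deriv j f)"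
  by (simp add: partial_derivs_def)

lemma smooth_differentiable: "smooth f \<Longrightarrow> f differentiable (at x)"
  unfolding smooth_def by (metis partial_derivs_simps(1))

lemma smooth_partial_deriv: "smooth f \<Longrightarrow> smooth (partial_deriv j f)"
  unfolding smooth_def by (metis partial_derivs_snoc)

lemma smooth_continuous_on: "smooth f \<Longrightarrow> continuous_on S f"
  by (meson continuous_at_imp_continuous_on differentiable_imp_continuous_within smooth_differentiable)

lemma smooth_iff_diff_times: "smooth f \<longleftrightarrow> (\<forall>n. diff_times n f)"
proof
  have "smooth f \<Longrightarrow> diff_times n f" for n
    by (induction n arbitrary: f) (simp_all add: smooth_differentiable smooth_partial_deriv)
  then show "smooth f \<Longrightarrow> \<forall>n. diff_times n f" by blast
next
  assume f: "\<forall>n. diff_times n f"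
  have "\<forall>x. partial_derivs js f differentiable (at x)" for js
    using f
  proof (induction js arbitrary: f rule: rev_induct)
    case Nil
    then have "diff_times 0 f" by blast
    then show ?case by simp
  next
    case (snoc j js)
    then have "diff_times (Suc n) f" for n by blast
    then have "\<forall>n. diff_times n (partial_deriv j f)" by simp
    from snoc.IH[OF this] show ?case by (simp add: partial_derivs_snoc)
  qed
  then show "smooth f" by (simp add: smooth_def)
qed

lemma diff_times_differentiable: "diff_times n f \<Longrightarrow> f differentiable (at x)"
  by (cases n) auto

lemma diff_times_Suc_imp: "diff_times (Suc n) f \<Longrightarrow> diff_times n f"
  by (induction n arbitrary: f) auto

lemma partial_deriv_eq: "(f has_derivative D) (at x) \<Longrightarrow> partial_deriv j f x = D (axis j 1)"
  unfolding partial_deriv_def using frechet_derivative_at by metis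

lemma has_derivative_frechet:
  "f differentiable (at x) \<Longrightarrow> (f has_derivative frechet_derivative f (at x)) (at x)"
  by (simp add: frechet_derivative_works)

lemma partial_deriv_linear:
  assumes "bounded_linear L" "\<And>x. f differentiable (at x)"
  shows "partial_deriv j (\<lambda>x. L (f x)) = (\<lambda>x. L (partial_deriv j f x))"
proof
  fix x
  have "((\<lambda>x. L (f x)) has_derivative (\<lambda>h. L (frechet_derivative f (at x) h))) (at x)"
    by (rule bounded_linear.has_derivative[OF assms(1) has_derivative_frechet[OF assms(2)]])
  then show "partial_deriv j (\<lambda>x. L (f x)) x = L (partial_deriv j f x)"
    by (simp add: partial_deriv_eq) (simp add: partial_deriv_def)
qed

lemma partial_deriv_add:
  assumes "\<And>x. f differentiable (at x)" "\<And>x. g differentiable (at x)"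
  shows "partial_deriv j (\<lambda>x. f x + g x) = (\<lambda>x. partial_deriv j f x + partial_deriv j g x)"
proof
  fix x
  have "((\<lambda>x. f x + g x) has_derivative
      (\<lambda>h. frechet_derivative f (at x) h + frechet_derivative g (at x) h)) (at x)"
    by (intro has_derivative_add has_derivative_frechet assms)
  then show "partial_deriv j (\<lambda>x. f x + g x) x = partial_deriv j f x + partial_deriv j g x"
    by (simp add: partial_deriv_eq) (simp add: partial_deriv_def)
qed

lemma partial_deriv_bilinear:
  assumes "bounded_bilinear B" "\<And>x. f differentiable (at x)" "\<And>x. g differentiable (at x)"
  shows "partial_deriv j (\<lambda>x. B (f x) (g x)) =
    (\<lambda>x. B (f x) (partial_deriv j g x) + B (partial_deriv j f x) (g x))"
proof
  fix x
  have "((\<lambda>x. B (f x) (g x)) has_derivative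
      (\<lambda>h. B (f x) (frechet_derivative g (at x) h) + B (frechet_derivative f (at x) h) (g x))) (at x)"
    by (intro bounded_bilinear.FDERIV[OF assms(1)] has_derivative_frechet assms)
  then show "partial_deriv j (\<lambda>x. B (f x) (g x)) x
      = B (f x) (partial_deriv j g x) + B (partial_deriv j f x) (g x)"
    by (simp add: partial_deriv_eq) (simp add: partial_deriv_def)
qed

lemma translate_has_derivative:
  assumes "f differentiable (at (x + a))"
  shows "((\<lambda>x. f (x + a)) has_derivative frechet_derivative f (at (x + a))) (at x)"
proof -
  have "((\<lambda>x. x + a) has_derivative (\<lambda>h. h)) (at x)"
    by (auto intro!: derivative_eq_intros)
  then show ?thesis
    using has_derivative_compose[of "\<lambda>x. x + a" "\<lambda>h. h" x UNIV f] has_derivative_frechet[OF assms]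
    by simp
qed

lemma partial_deriv_translate:
  assumes "\<And>x. f differentiable (at x)"
  shows "partial_deriv j (\<lambda>x. f (x + a)) = (\<lambda>x. partial_deriv j f (x + a))"
  using partial_deriv_eq[OF translate_has_derivative[OF assms]]
  by (auto simp: fun_eq_iff) (simp add: partial_deriv_def)

lemma partial_derivs_linear:
  assumes "bounded_linear L" "smooth f"
  shows "partial_derivs js (\<lambda>x. L (f x)) = (\<lambda>x. L (partial_derivs js f x))"
  using assms by (induction js) (simp_all add: partial_deriv_linear smooth_def)

lemma smooth_linear:
  assumes L: "bounded_linear L" and f: "smooth f"
  shows "smooth (\<lambda>x. L (f x))"
  unfolding smooth_def partial_derivs_linear[OF assms]
proof (intro allI)
  fix js x
  have "partial_derivs js f differentiable (at x)" using f by (simp add: smooth_def)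
  then show "(\<lambda>x. L (partial_derivs js f x)) differentiable (at x)"
    unfolding differentiable_def using bounded_linear.has_derivative[OF L] by blast
qed

lemma diff_times_add: "diff_times n f \<Longrightarrow> diff_times n g \<Longrightarrow> diff_times n (\<lambda>x. f x + g x)"
  by (induction n arbitrary: f g) (simp_all add: partial_deriv_add)

lemma diff_times_bilinear:
  assumes B: "bounded_bilinear B"
  shows "diff_times n f \<Longrightarrow> diff_times n g \<Longrightarrow> diff_times n (\<lambda>x. B (f x) (g x))"
proof (induction n arbitrary: f g)
  case 0
  then show ?case
    using bounded_bilinear.FDERIV[OF B has_derivative_frechet has_derivative_frechet]
    unfolding diff_times.simps differentiable_def by blast
next
  case (Suc n)
  then have d: "\<And>x. f differentiable (at x)" "\<And>x. g differentiable (at x)"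
    and fn: "diff_times n f" "diff_times n g"
    using diff_times_Suc_imp by auto
  have "diff_times n (\<lambda>x. B (f x) (partial_deriv j g x) + B (partial_deriv j f x) (g x))" for j
    using Suc fn by (intro diff_times_add Suc.IH) auto
  then have "diff_times n (partial_deriv j (\<lambda>x. B (f x) (g x)))" for j
    unfolding partial_deriv_bilinear[OF B d] .
  moreover have "(\<lambda>x. B (f x) (g x)) differentiable (at x)" for x
    using diff_times_differentiable[OF Suc.IH[OF fn]] .
  ultimately show ?case by simp
qed

lemma diff_times_translate: "diff_times n f \<Longrightarrow> diff_times n (\<lambda>x. f (x + a))"
proof (induction n arbitrary: f)
  case 0
  then show ?case
    using translate_has_derivative unfolding diff_times.simps differentiable_def by blast
next
  case (Suc n)
  then have "diff_times n (\<lambda>x. f (x + a))"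
    using diff_times_Suc_imp by blast
  then show ?case
    using Suc diff_times_differentiable by (simp add: partial_deriv_translate) blast
qed

lemma smooth_bilinear: "bounded_bilinear B \<Longrightarrow> smooth f \<Longrightarrow> smooth g \<Longrightarrow> smooth (\<lambda>x. B (f x) (g x))"
  by (simp add: smooth_iff_diff_times diff_times_bilinear)

lemma smooth_translate: "smooth f \<Longrightarrow> smooth (\<lambda>x. f (x + a))"
  by (simp add: smooth_iff_diff_times diff_times_translate)

lemma partial_derivs_const:
  "partial_derivs js (\<lambda>_ :: real ^ 'd. c :: 'b :: real_normed_vector) = (\<lambda>_. if js = [] then c else 0)"
proof (induction js)
  case (Cons j js)
  have "partial_deriv j (\<lambda>_ :: real ^ 'd. b) = (\<lambda>_. 0)" for b :: 'b
    by (rule ext) (rule partial_deriv_eq[OF has_derivative_const])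
  then show ?case using Cons by simp
qed simp

lemma smooth_const: "smooth (\<lambda>_. c)"
  by (simp add: smooth_def partial_derivs_const)

lemma smooth_matrix_mult:
  "smooth F \<Longrightarrow> smooth K \<Longrightarrow> smooth (\<lambda>x. F x ** K x)"
  for F :: "real ^ 'd \<Rightarrow> complex ^ 'n ^ 'n"
  by (rule smooth_bilinear[OF bounded_bilinear_matrix_mult])

lemma smooth_mat_adjoint:
  "smooth F \<Longrightarrow> smooth (\<lambda>x. mat_adjoint (F x))"
  for F :: "real ^ 'd \<Rightarrow> complex ^ 'n ^ 'n"
  by (rule smooth_linear[OF bounded_linear_mat_adjoint])

lemma Cinf_maps_mult_left:
  fixes G :: "(complex ^ 'n ^ 'n) set"
  assumes "compact_lie_group G" "S \<in> G" "F \<in> Cinf_maps G"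
  shows "(\<lambda>x. S ** F x) \<in> Cinf_maps G"
  using assms by (simp add: Cinf_maps_def Cinf_torus_iff smooth_matrix_mult smooth_const lie_group_mult)

lemma Cinf_tendsto_matrix_mult_const:
  fixes M :: "nat \<Rightarrow> real ^ 'd \<Rightarrow> complex ^ 'n ^ 'n" and R S' :: "complex ^ 'n ^ 'n"
  assumes M: "\<And>i. smooth (M i)" and lim: "Cinf_tendsto M (\<lambda>_. C)" and S: "S \<longlonglongrightarrow> S'"
  shows "Cinf_tendsto (\<lambda>i x. S i ** M i x ** R) (\<lambda>_. S' ** C ** R)"
  unfolding Cinf_tendsto_def
proof
  fix js
  have lin: "bounded_linear (\<lambda>X. A ** X ** R)" for A :: "complex ^ 'n ^ 'n"
    by (rule bounded_linear_compose[OF matrix_mult.bounded_linear_left matrix_mult.bounded_linear_right])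
  have "uniform_limit UNIV (\<lambda>i x. S i) (\<lambda>x. S') sequentially"
    using S by (simp add: uniform_limit_iff tendsto_iff)
  moreover have "uniform_limit UNIV (\<lambda>i. partial_derivs js (M i)) (partial_derivs js (\<lambda>_. C)) sequentially"
    using lim by (simp add: Cinf_tendsto_def)
  moreover have "bounded (range (partial_derivs js (\<lambda>_ :: real ^ 'd. C)))"
    by (simp add: partial_derivs_const)
  ultimately have "uniform_limit UNIV (\<lambda>i x. S i ** partial_derivs js (M i) x)
      (\<lambda>x. S' ** partial_derivs js (\<lambda>_. C) x) sequentially"
    by (intro matrix_mult.bounded_uniform_limit) auto
  then have "uniform_limit UNIV (\<lambda>i x. S i ** partial_derivs js (M i) x ** R)
      (\<lambda>x :: real ^ 'd. S' ** partial_derivs js (\<lambda>_. C) x ** R) sequentially"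
    by (rule bounded_linear.uniform_limit[OF matrix_mult.bounded_linear_left])
  moreover have "partial_derivs js (\<lambda>x. S i ** M i x ** R) = (\<lambda>x. S i ** partial_derivs js (M i) x ** R)" for i
    by (rule partial_derivs_linear[OF lin M])
  moreover have "partial_derivs js (\<lambda>_ :: real ^ 'd. S' ** C ** R)
      = (\<lambda>x. S' ** partial_derivs js (\<lambda>_. C) x ** R)"
    by (rule partial_derivs_linear[OF lin smooth_const])
  ultimately show "uniform_limit UNIV (\<lambda>i. partial_derivs js (\<lambda>x. S i ** M i x ** R))
      (partial_derivs js (\<lambda>_. S' ** C ** R)) sequentially"
    by (simp only:)
qed

lemma Cinf_tendsto_subseq:
  assumes "Cinf_tendsto F f" "strict_mono r"
  shows "Cinf_tendsto (\<lambda>i. F (r i)) f"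
  using assms filterlim_compose[OF _ filterlim_subseq[OF assms(2)]]
  unfolding Cinf_tendsto_def by blast

lemma Cinf_tendsto_pointwise:
  assumes "Cinf_tendsto F f"
  shows "(\<lambda>i. F i x) \<longlonglongrightarrow> f x"
proof -
  have "uniform_limit UNIV (\<lambda>i. partial_derivs [] (F i)) (partial_derivs [] f) sequentially"
    using assms unfolding Cinf_tendsto_def by blast
  then show ?thesis
    by (simp add: tendsto_uniform_limitI)
qed

section \<open>Compactness in Sobolev spaces of negative order\<close>

lemma dominated_infsum_tendsto_0:
  fixes a :: "nat \<Rightarrow> 'k \<Rightarrow> real"
  assumes w: "w summable_on UNIV" and a0: "\<And>i k. 0 \<le> a i k" and aw: "\<And>i k. a i k \<le> w k"
    and lim: "\<And>k. (\<lambda>i. a i k) \<longlonglongrightarrow> 0"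
  shows "(\<lambda>i. infsum (a i) UNIV) \<longlonglongrightarrow> 0"
proof (rule LIMSEQ_I)
  fix e :: real assume "e > 0"
  have split: "infsum f UNIV = sum f X + infsum f (- X)" if "finite X" "f summable_on UNIV"
    for f :: "'k \<Rightarrow> real" and X
    using infsum_Un_disjoint[of f X "- X"] that
    by (simp add: summable_on_subset_banach[OF that(2)] Compl_partition)
  have asum: "a i summable_on UNIV" for i
    by (rule summable_on_comparison_test[OF w]) (auto simp: a0 aw)
  have "\<forall>\<^sub>F X in finite_subsets_at_top UNIV. infsum w UNIV - e / 2 < sum w X"
    using infsum_tendsto[OF w] \<open>e > 0\<close> by (intro order_tendstoD) auto
  then obtain X where X: "finite X" and wX: "infsum w UNIV - e / 2 < sum w X"
    by (auto simp: eventually_finite_subsets_at_top)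
  have tail: "infsum (a i) (- X) < e / 2" for i
  proof -
    have "infsum (a i) (- X) \<le> infsum w (- X)"
      by (intro infsum_mono summable_on_subset_banach[OF asum] summable_on_subset_banach[OF w] aw) auto
    also have "\<dots> < e / 2" using split[OF X w] wX by simp
    finally show ?thesis .
  qed
  have "(\<lambda>i. sum (a i) X) \<longlonglongrightarrow> (\<Sum>k\<in>X. 0)"
    by (intro tendsto_sum lim)
  then have "\<forall>\<^sub>F i in sequentially. sum (a i) X < e / 2"
    using \<open>e > 0\<close> by (intro order_tendstoD) auto
  then obtain n0 where n0: "\<And>i. i \<ge> n0 \<Longrightarrow> sum (a i) X < e / 2"
    by (auto simp: eventually_sequentially)
  have "norm (infsum (a i) UNIV - 0) < e" if "i \<ge> n0" for i
    using n0[OF that] tail[of i] split[OF X asum, of i] infsum_nonneg[of UNIV "a i"] a0 by simp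
  then show "\<exists>n0. \<forall>i\<ge>n0. norm (infsum (a i) UNIV - 0) < e" by blast
qed

lemma sum_inverse_one_plus_square_le:
  "(\<Sum>m\<in>{- int N..int N}. 1 / (1 + (real_of_int m)\<^sup>2)) \<le> 4 - 2 / real N"
proof (induction N)
  case (Suc N)
  have "{- int (Suc N)..int (Suc N)} = insert (- int (Suc N)) (insert (int (Suc N)) {- int N..int N})"
    by auto
  then have eq: "(\<Sum>m\<in>{- int (Suc N)..int (Suc N)}. 1 / (1 + (real_of_int m)\<^sup>2)) =
      (\<Sum>m\<in>{- int N..int N}. 1 / (1 + (real_of_int m)\<^sup>2)) + 2 / (1 + (real (Suc N))\<^sup>2)"
    by (simp add: power2_eq_square algebra_simps)
  show ?case
  proof (cases "N = 0")
    case False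
    then have N: "real N > 0" by simp
    have "2 / (1 + (real (Suc N))\<^sup>2) \<le> 2 / (real N * real (Suc N))"
      using N by (intro frac_le mult_pos_pos) (auto simp: power2_eq_square algebra_simps)
    also have "\<dots> = 2 / real N - 2 / real (Suc N)"
      using N by (simp add: field_simps)
    finally show ?thesis using Suc eq by linarith
  next
    case True
    then show ?thesis unfolding eq by simp
  qed
qed simp

lemma summable_lattice_weight:
  assumes s: "s \<le> - real CARD('d)"
  shows "(\<lambda>k :: int ^ 'd. (1 + (norm (ivec k))\<^sup>2) powr s) summable_on UNIV"
proof (rule nonneg_bdd_above_summable_on)
  let ?h = "\<lambda>m :: int. 1 / (1 + (real_of_int m)\<^sup>2)"
  have le: "(1 + (norm (ivec k))\<^sup>2) powr s \<le> (\<Prod>j\<in>UNIV. ?h (k $ j))" for k :: "int ^ 'd"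
  proof -
    let ?a = "1 + (norm (ivec k))\<^sup>2"
    have "?a powr s \<le> ?a powr (- real CARD('d))"
      using s by (intro powr_mono) auto
    also have "\<dots> = (\<Prod>j\<in>(UNIV :: 'd set). 1 / ?a)"
      by (simp add: powr_minus powr_realpow add_pos_nonneg power_one_over inverse_eq_divide)
    also have "\<dots> \<le> (\<Prod>j\<in>UNIV. ?h (k $ j))"
    proof (intro prod_mono conjI divide_left_mono)
      fix j :: 'd
      have "\<bar>real_of_int (k $ j)\<bar> \<le> norm (ivec k)"
        using component_le_norm_cart[of "ivec k" j] by (simp add: ivec_def)
      then show "1 + (real_of_int (k $ j))\<^sup>2 \<le> ?a"
        using abs_le_square_iff[of "real_of_int (k $ j)" "norm (ivec k)"] by simp
    qed (auto intro!: add_pos_nonneg mult_pos_pos)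
    finally show ?thesis .
  qed
  show "bdd_above (sum (\<lambda>k :: int ^ 'd. (1 + (norm (ivec k))\<^sup>2) powr s) ` {F. F \<subseteq> UNIV \<and> finite F})"
  proof (rule bdd_aboveI2)
    fix F :: "(int ^ 'd) set" assume "F \<in> {F. F \<subseteq> UNIV \<and> finite F}"
    then have "finite F" by simp
    define N where "N = (\<Sum>k\<in>F. \<Sum>j\<in>UNIV. nat \<bar>k $ j\<bar>)"
    have N: "nat \<bar>k $ j\<bar> \<le> N" if "k \<in> F" for k j
    proof -
      have "nat \<bar>k $ j\<bar> \<le> (\<Sum>j\<in>UNIV. nat \<bar>k $ j\<bar>)"
        by (rule member_le_sum) auto
      also have "\<dots> \<le> N"
        unfolding N_def by (rule member_le_sum[where f = "\<lambda>k. \<Sum>j\<in>UNIV. nat \<bar>k $ j\<bar>"])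
          (use that \<open>finite F\<close> in auto)
      finally show ?thesis .
    qed
    have "(\<Sum>k\<in>F. (1 + (norm (ivec k))\<^sup>2) powr s) \<le> (\<Sum>k\<in>F. \<Prod>j\<in>UNIV. ?h (k $ j))"
      by (intro sum_mono le)
    also have "\<dots> = (\<Sum>g\<in>($) ` F. \<Prod>j\<in>UNIV. ?h (g j))"
      by (simp add: sum.reindex inj_on_def vec_nth_inject)
    also have "\<dots> \<le> (\<Sum>g\<in>Pi\<^sub>E (UNIV :: 'd set) (\<lambda>_. {- int N..int N}). \<Prod>j\<in>UNIV. ?h (g j))"
    proof (rule sum_mono2)
      have "- int N \<le> k $ j \<and> k $ j \<le> int N" if "k \<in> F" for k j
        using N[OF that, of j] by linarith
      then show "($) ` F \<subseteq> Pi\<^sub>E UNIV (\<lambda>_. {- int N..int N})" by auto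
    qed (auto intro!: finite_PiE prod_nonneg)
    also have "\<dots> = (\<Prod>j\<in>(UNIV :: 'd set). \<Sum>m\<in>{- int N..int N}. ?h m)"
      by (rule prod_sum_PiE[symmetric]) auto
    also have "\<dots> \<le> (\<Prod>j\<in>(UNIV :: 'd set). 4)"
    proof (intro prod_mono conjI sum_nonneg)
      have "0 \<le> 2 / real N" by simp
      then show "(\<Sum>m\<in>{- int N..int N}. ?h m) \<le> 4"
        using sum_inverse_one_plus_square_le[of N] by linarith
    qed auto
    finally show "(\<Sum>k\<in>F. (1 + (norm (ivec k))\<^sup>2) powr s) \<le> (\<Prod>j\<in>(UNIV :: 'd set). 4)" .
  qed
qed auto

definition bounded_functional :: "real \<Rightarrow> ((real ^ 'd \<Rightarrow> complex) \<Rightarrow> complex) \<Rightarrow> bool" where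
  "bounded_functional K u \<longleftrightarrow>
     (\<forall>\<phi> \<psi>. continuous_on UNIV \<phi> \<longrightarrow> continuous_on UNIV \<psi> \<longrightarrow> u (\<lambda>x. \<phi> x + \<psi> x) = u \<phi> + u \<psi>) \<and>
     (\<forall>c \<phi>. continuous_on UNIV \<phi> \<longrightarrow> u (\<lambda>x. c * \<phi> x) = c * u \<phi>) \<and>
     (\<forall>\<phi> B. continuous_on UNIV \<phi> \<longrightarrow> (\<forall>x\<in>cbox 0 (\<chi> j. 1). cmod (\<phi> x) \<le> B) \<longrightarrow> cmod (u \<phi>) \<le> K * B)"

lemma
  assumes "bounded_functional K u"
  shows bounded_functional_add: "continuous_on UNIV \<phi> \<Longrightarrow> continuous_on UNIV \<psi> \<Longrightarrow>
      u (\<lambda>x. \<phi> x + \<psi> x) = u \<phi> + u \<psi>"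
    and bounded_functional_scale: "continuous_on UNIV \<phi> \<Longrightarrow> u (\<lambda>x. c * \<phi> x) = c * u \<phi>"
    and bounded_functional_bound: "continuous_on UNIV \<phi> \<Longrightarrow>
      (\<And>x. x \<in> cbox 0 (\<chi> j. 1) \<Longrightarrow> cmod (\<phi> x) \<le> B) \<Longrightarrow> cmod (u \<phi>) \<le> K * B"
  using assms unfolding bounded_functional_def by blast+

lemma bounded_functional_distr_of:
  fixes f :: "real ^ 'd \<Rightarrow> complex"
  assumes f: "continuous_on UNIV f" and f1: "\<And>x. cmod (f x) \<le> 1"
  shows "bounded_functional (measure lborel (cbox 0 (\<chi> j. 1) :: (real ^ 'd) set)) (distr_of f)"
proof -
  let ?Q = "cbox 0 (\<chi> j. 1) :: (real ^ 'd) set"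
  have int: "(\<lambda>x. f x * \<phi> x) integrable_on ?Q" if "continuous_on UNIV \<phi>" for \<phi>
    by (intro integrable_continuous continuous_on_mult continuous_on_subset[OF f]
        continuous_on_subset[OF that]) auto
  show ?thesis
    unfolding bounded_functional_def
  proof (intro conjI allI impI)
    fix \<phi> \<psi> :: "real ^ 'd \<Rightarrow> complex" assume "continuous_on UNIV \<phi>" "continuous_on UNIV \<psi>"
    then show "distr_of f (\<lambda>x. \<phi> x + \<psi> x) = distr_of f \<phi> + distr_of f \<psi>"
      unfolding distr_of_def by (simp add: distrib_left integral_add int)
  next
    fix c and \<phi> :: "real ^ 'd \<Rightarrow> complex"
    have "(\<lambda>x. f x * (c * \<phi> x)) = (\<lambda>x. c * (f x * \<phi> x))" by (simp add: fun_eq_iff)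
    then show "distr_of f (\<lambda>x. c * \<phi> x) = c * distr_of f \<phi>"
      unfolding distr_of_def by simp
  next
    fix \<phi> :: "real ^ 'd \<Rightarrow> complex" and B
    assume \<phi>: "continuous_on UNIV \<phi>" and B: "\<forall>x\<in>?Q. cmod (\<phi> x) \<le> B"
    have "(0 :: real ^ 'd) \<in> ?Q" by (simp add: mem_box_cart)
    then have "0 \<le> B" using B norm_ge_zero order.trans by blast
    have "cmod (f x * \<phi> x) \<le> B" if "x \<in> ?Q" for x
      using mult_mono[OF f1[of x] B[rule_format, OF that]] by (simp add: norm_mult)
    then show "cmod (distr_of f \<phi>) \<le> measure lborel ?Q * B"
      unfolding distr_of_def
      using has_integral_bound[OF \<open>0 \<le> B\<close> integrable_integral[OF int[OF \<phi>]]]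
      by (simp add: mult.commute)
  qed
qed

lemma continuous_character:
  "continuous_on UNIV (\<lambda>x. cis (- 2 * pi * (ivec k \<bullet> x)))"
  by (intro continuous_intros)

lemma Cinf_torus_continuous: "\<phi> \<in> Cinf_torus \<Longrightarrow> continuous_on UNIV \<phi>"
  by (simp add: Cinf_torus_iff smooth_continuous_on)

lemma fourier_coeff_bound:
  assumes "bounded_functional K u"
  shows "cmod (fourier_coeff u k) \<le> K"
  using bounded_functional_bound[OF assms continuous_character[of k], where B = 1] by (simp add: fourier_coeff_def)

lemma bounded_functional_distribution:
  fixes u :: "(real ^ 'd \<Rightarrow> complex) \<Rightarrow> complex"
  assumes u: "bounded_functional K u"
  shows "distribution u"
  unfolding distribution_def
proof (intro conjI ballI allI impI)
  fix \<phi> \<psi> :: "real ^ 'd \<Rightarrow> complex" assume "\<phi> \<in> Cinf_torus" "\<psi> \<in> Cinf_torus"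
  then show "u (\<lambda>x. \<phi> x + \<psi> x) = u \<phi> + u \<psi>"
    by (intro bounded_functional_add[OF u] Cinf_torus_continuous)
next
  fix c and \<phi> :: "real ^ 'd \<Rightarrow> complex" assume "\<phi> \<in> Cinf_torus"
  then show "u (\<lambda>x. c * \<phi> x) = c * u \<phi>"
    by (intro bounded_functional_scale[OF u] Cinf_torus_continuous)
next
  fix \<Phi> and \<phi> :: "real ^ 'd \<Rightarrow> complex"
  assume *: "(\<forall>i. \<Phi> i \<in> Cinf_torus) \<and> \<phi> \<in> Cinf_torus \<and> Cinf_tendsto \<Phi> \<phi>"
  then have c\<Phi>: "\<And>i. continuous_on UNIV (\<Phi> i)" and c\<phi>: "continuous_on UNIV \<phi>"
    by (auto intro: Cinf_torus_continuous)
  have "uniform_limit UNIV (\<lambda>i. partial_derivs [] (\<Phi> i)) (partial_derivs [] \<phi>) sequentially"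
    using * unfolding Cinf_tendsto_def by blast
  then have ul: "uniform_limit UNIV \<Phi> \<phi> sequentially" by simp
  have K: "0 \<le> K" using fourier_coeff_bound[OF u, of 0] norm_ge_zero order.trans by blast
  show "(\<lambda>i. u (\<Phi> i)) \<longlonglongrightarrow> u \<phi>"
  proof (rule LIMSEQ_I)
    fix e :: real assume "e > 0"
    then have "e / (K + 1) > 0" using K by simp
    then obtain n0 where n0: "\<And>i x. i \<ge> n0 \<Longrightarrow> dist (\<Phi> i x) (\<phi> x) < e / (K + 1)"
      using ul unfolding uniform_limit_sequentially_iff by blast
    have "norm (u (\<Phi> i) - u \<phi>) < e" if "i \<ge> n0" for i
    proof -
      have c: "continuous_on UNIV (\<lambda>x. (- 1) * \<phi> x)" by (intro continuous_intros c\<phi>)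
      have "u (\<lambda>x. \<Phi> i x + (- 1) * \<phi> x) = u (\<Phi> i) + (- 1) * u \<phi>"
        using bounded_functional_add[OF u c\<Phi>[of i] c] bounded_functional_scale[OF u c\<phi>, where c = "- 1"]
        by simp
      moreover have "cmod (u (\<lambda>x. \<Phi> i x + (- 1) * \<phi> x)) \<le> K * (e / (K + 1))"
        using n0[OF that]
        by (intro bounded_functional_bound[OF u] continuous_on_add c\<Phi> c) (simp add: dist_norm less_imp_le)
      moreover have "K * (e / (K + 1)) < e"
        using K \<open>e > 0\<close> by (simp add: field_simps)
      ultimately show ?thesis by simp
    qed
    then show "\<exists>n0. \<forall>i\<ge>n0. norm (u (\<Phi> i) - u \<phi>) < e" by blast
  qed
qed

lemma bounded_functional_Hs_space:
  fixes u :: "(real ^ 'd \<Rightarrow> complex) \<Rightarrow> complex"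
  assumes u: "bounded_functional K u" and s: "s \<le> - real CARD('d)"
  shows "u \<in> Hs_space s"
proof -
  have "(\<lambda>k :: int ^ 'd. (1 + (norm (ivec k))\<^sup>2) powr s * K\<^sup>2) summable_on UNIV"
    by (rule summable_on_cmult_left[OF summable_lattice_weight[OF s]])
  then have "(\<lambda>k :: int ^ 'd. (1 + (norm (ivec k))\<^sup>2) powr s * (cmod (fourier_coeff u k))\<^sup>2) summable_on UNIV"
    by (rule summable_on_comparison_test)
      (use fourier_coeff_bound[OF u] in \<open>auto intro!: mult_left_mono power_mono\<close>)
  then show ?thesis
    using bounded_functional_distribution[OF u] by (simp add: Hs_space_def)
qed

lemma bounded_functional_Hs_tendsto:
  fixes u :: "(real ^ 'd \<Rightarrow> complex) \<Rightarrow> complex"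
  assumes U: "\<And>i. bounded_functional K (U i)" and u: "bounded_functional K u"
    and lim: "\<And>k. (\<lambda>i. fourier_coeff (U i) k) \<longlonglongrightarrow> fourier_coeff u k"
    and s: "s \<le> - real CARD('d)"
  shows "Hs_tendsto s U u"
  unfolding Hs_tendsto_def
proof (intro conjI allI)
  show "U i \<in> Hs_space s" for i by (rule bounded_functional_Hs_space[OF U s])
  show "u \<in> Hs_space s" by (rule bounded_functional_Hs_space[OF u s])
  let ?a = "\<lambda>i k. (1 + (norm (ivec k))\<^sup>2) powr s * (cmod (fourier_coeff (\<lambda>\<phi>. U i \<phi> - u \<phi>) k))\<^sup>2"
  have coeff: "fourier_coeff (\<lambda>\<phi>. U i \<phi> - u \<phi>) k = fourier_coeff (U i) k - fourier_coeff u k" for i k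
    by (simp add: fourier_coeff_def)
  have "(\<lambda>i. infsum (?a i) UNIV) \<longlonglongrightarrow> 0"
  proof (rule dominated_infsum_tendsto_0)
    show "(\<lambda>k :: int ^ 'd. (1 + (norm (ivec k))\<^sup>2) powr s * (K + K)\<^sup>2) summable_on UNIV"
      by (rule summable_on_cmult_left[OF summable_lattice_weight[OF s]])
    show "0 \<le> ?a i k" for i k by simp
    show "?a i k \<le> (1 + (norm (ivec k))\<^sup>2) powr s * (K + K)\<^sup>2" for i k
      unfolding coeff
      by (intro mult_left_mono power_mono order.trans[OF norm_triangle_ineq4 add_mono]
          fourier_coeff_bound[OF U] fourier_coeff_bound[OF u]) auto
    fix k
    have "(\<lambda>i. ?a i k) \<longlonglongrightarrow>
        (1 + (norm (ivec k))\<^sup>2) powr s * (cmod (fourier_coeff u k - fourier_coeff u k))\<^sup>2"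
      unfolding coeff by (intro tendsto_mult tendsto_const tendsto_power tendsto_norm tendsto_diff lim)
    then show "(\<lambda>i. ?a i k) \<longlonglongrightarrow> 0" by simp
  qed
  then show "(\<lambda>i. Hs_norm s (\<lambda>\<phi>. U i \<phi> - u \<phi>)) \<longlonglongrightarrow> 0"
    unfolding Hs_norm_def using tendsto_real_sqrt by fastforce
qed

lemma compact_PiE_UNIV:
  fixes S :: "'a \<Rightarrow> 'b :: topological_space set"
  assumes "\<And>i. compact (S i)"
  shows "compact (Pi\<^sub>E UNIV S)"
proof -
  have "compactin (product_topology (\<lambda>i. euclidean) UNIV) (Pi\<^sub>E UNIV S)"
    unfolding compactin_PiE using assms by simp
  then show ?thesis by (simp add: euclidean_product_topology)
qed

lemma tendsto_eval: "((\<lambda>w. w i) \<longlongrightarrow> u i) (nhds u)"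
  for u :: "'a \<Rightarrow> 'b :: topological_space"
proof -
  have "((\<lambda>w :: 'a \<Rightarrow> 'b. w i) \<longlongrightarrow> u i) (at u)"
    using continuous_on_product_coordinates[of i] unfolding continuous_on_def by blast
  then show ?thesis
    using tendsto_at_iff_tendsto_nhds[of "\<lambda>w. w i" u] by blast
qed

text \<open>
  A cluster point in the product topology; the functionals are cut off at discontinuous test
  functions, where no bound is available.
\<close>

lemma bounded_functional_cluster:
  fixes U :: "nat \<Rightarrow> (real ^ 'd \<Rightarrow> complex) \<Rightarrow> complex"
  assumes U: "\<And>i. bounded_functional K (U i)"
    and lim: "\<And>k. (\<lambda>i. fourier_coeff (U i) k) \<longlonglongrightarrow> c k"
  obtains u where "bounded_functional K u" "\<And>k. fourier_coeff u k = c k"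
proof -
  let ?Q = "cbox 0 (\<chi> j. 1) :: (real ^ 'd) set"
  define v where "v i \<phi> = (if continuous_on UNIV \<phi> then U i \<phi> else 0)" for i and \<phi> :: "real ^ 'd \<Rightarrow> complex"
  have "\<exists>b. \<forall>i. cmod (v i \<phi>) \<le> b" for \<phi>
  proof (cases "continuous_on UNIV \<phi>")
    case True
    have "compact (\<phi> ` ?Q)"
      by (intro compact_continuous_image continuous_on_subset[OF True] compact_cbox) auto
    then obtain B where "\<And>x. x \<in> ?Q \<Longrightarrow> cmod (\<phi> x) \<le> B"
      using compact_imp_bounded bounded_iff by (metis image_eqI)
    then show ?thesis
      using bounded_functional_bound[OF U True] True by (auto simp: v_def)
  qed (auto simp: v_def)
  then obtain b where b: "\<And>i \<phi>. cmod (v i \<phi>) \<le> b \<phi>" by metis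
  have "compact (Pi\<^sub>E UNIV (\<lambda>\<phi>. cball 0 (b \<phi>) :: complex set))"
    by (intro compact_PiE_UNIV compact_cball)
  moreover have "filtermap v sequentially \<noteq> bot"
    by (simp add: filtermap_bot_iff)
  moreover have "\<forall>\<^sub>F w in filtermap v sequentially. w \<in> Pi\<^sub>E UNIV (\<lambda>\<phi>. cball 0 (b \<phi>))"
    using b by (simp add: eventually_filtermap PiE_iff)
  ultimately obtain u where nbot: "inf (nhds u) (filtermap v sequentially) \<noteq> bot"
    unfolding compact_filter by blast
  define F where "F = inf (nhds u) (filtermap v sequentially)"
  have Fbot: "F \<noteq> bot" using nbot by (simp add: F_def)
  have ev: "\<forall>\<^sub>F w in F. P w" if "\<And>i. P (v i)" for P
    unfolding F_def
    by (rule filter_leD[OF inf_le2]) (simp add: eventually_filtermap that)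
  have evalF: "((\<lambda>w. w \<phi>) \<longlongrightarrow> u \<phi>) F" for \<phi>
    unfolding F_def by (rule tendsto_mono[OF inf_le1 tendsto_eval])
  have "bounded_functional K u"
    unfolding bounded_functional_def
  proof (intro conjI allI impI)
    fix \<phi> \<psi> :: "real ^ 'd \<Rightarrow> complex" assume c: "continuous_on UNIV \<phi>" "continuous_on UNIV \<psi>"
    have "((\<lambda>w. w \<phi> + w \<psi>) \<longlongrightarrow> u \<phi> + u \<psi>) F"
      by (intro tendsto_add evalF)
    moreover have "\<forall>\<^sub>F w in F. w \<phi> + w \<psi> = w (\<lambda>x. \<phi> x + \<psi> x)"
      by (rule ev) (simp add: v_def c continuous_on_add bounded_functional_add[OF U])
    ultimately have "((\<lambda>w. w (\<lambda>x. \<phi> x + \<psi> x)) \<longlongrightarrow> u \<phi> + u \<psi>) F"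
      by (rule Lim_transform_eventually)
    with Fbot evalF show "u (\<lambda>x. \<phi> x + \<psi> x) = u \<phi> + u \<psi>" by (rule tendsto_unique)
  next
    fix a and \<phi> :: "real ^ 'd \<Rightarrow> complex" assume c: "continuous_on UNIV \<phi>"
    have "((\<lambda>w. a * w \<phi>) \<longlongrightarrow> a * u \<phi>) F"
      by (intro tendsto_mult tendsto_const evalF)
    moreover have "\<forall>\<^sub>F w in F. a * w \<phi> = w (\<lambda>x. a * \<phi> x)"
      by (rule ev) (simp add: v_def c continuous_on_mult_left bounded_functional_scale[OF U])
    ultimately have "((\<lambda>w. w (\<lambda>x. a * \<phi> x)) \<longlongrightarrow> a * u \<phi>) F"
      by (rule Lim_transform_eventually)
    with Fbot evalF show "u (\<lambda>x. a * \<phi> x) = a * u \<phi>" by (rule tendsto_unique)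
  next
    fix \<phi> :: "real ^ 'd \<Rightarrow> complex" and B
    assume c: "continuous_on UNIV \<phi>" and B: "\<forall>x\<in>?Q. cmod (\<phi> x) \<le> B"
    have "\<forall>\<^sub>F w in F. cmod (w \<phi>) \<le> K * B"
      by (rule ev) (use bounded_functional_bound[OF U c] B c in \<open>simp add: v_def\<close>)
    then show "cmod (u \<phi>) \<le> K * B"
      by (rule tendsto_upperbound[OF tendsto_norm[OF evalF] _ Fbot])
  qed
  moreover have "fourier_coeff u k = c k" for k
  proof (rule tendsto_unique[OF Fbot])
    let ?e = "\<lambda>x. cis (- 2 * pi * (ivec k \<bullet> x))"
    show "((\<lambda>w. w ?e) \<longlongrightarrow> fourier_coeff u k) F"
      unfolding fourier_coeff_def by (rule evalF)
    have "(\<lambda>i. v i ?e) \<longlonglongrightarrow> c k"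
      using lim[of k] continuous_character[of k] by (simp add: v_def fourier_coeff_def)
    then have "((\<lambda>w. w ?e) \<longlongrightarrow> c k) (filtermap v sequentially)"
      by (simp add: filterlim_filtermap)
    then show "((\<lambda>w. w ?e) \<longlongrightarrow> c k) F"
      unfolding F_def by (rule tendsto_mono[OF inf_le2])
  qed
  ultimately show ?thesis by (rule that)
qed

lemma Hs_map_convergent_subsequence:
  fixes F :: "nat \<Rightarrow> real ^ 'd \<Rightarrow> complex ^ 'n ^ 'n"
  assumes G: "compact_lie_group G" and F: "\<And>i. F i \<in> Cinf_maps G" and s: "s \<le> - real CARD('d)"
  obtains r U where "strict_mono r" "Hs_map_tendsto s (\<lambda>i. F (r i)) U"
proof -
  define K where "K = measure lborel (cbox 0 (\<chi> j. 1) :: (real ^ 'd) set)"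
  let ?u = "\<lambda>i p q. distr_of (\<lambda>x. F i x $ p $ q)"
  have bf: "bounded_functional K (?u i p q)" for i p q
    unfolding K_def
  proof (rule bounded_functional_distr_of)
    have "continuous_on UNIV (F i)"
      using F[of i] by (auto simp: Cinf_maps_def intro: Cinf_torus_continuous smooth_continuous_on[of "F i"] simp: Cinf_torus_iff)
    then show "continuous_on UNIV (\<lambda>x. F i x $ p $ q)"
      by (intro continuous_on_component)
    show "cmod (F i x $ p $ q) \<le> 1" for x
      using F[of i] by (intro unitary_entry_le_1 lie_group_unitary[OF G]) (auto simp: Cinf_maps_def)
  qed
  define c :: "nat \<Rightarrow> (int ^ 'd) \<times> 'n \<times> 'n \<Rightarrow> complex"
    where "c i = (\<lambda>(k, p, q). fourier_coeff (?u i p q) k)" for i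
  have "compact (Pi\<^sub>E UNIV (\<lambda>_. cball 0 K) :: ((int ^ 'd) \<times> 'n \<times> 'n \<Rightarrow> complex) set)"
    by (intro compact_PiE_UNIV compact_cball)
  moreover have "c i \<in> Pi\<^sub>E UNIV (\<lambda>_. cball 0 K)" for i
    using fourier_coeff_bound[OF bf] by (auto simp: c_def)
  ultimately obtain l r where r: "strict_mono r" and l: "(c \<circ> r) \<longlonglongrightarrow> l"
    using compact_imp_seq_compact unfolding seq_compact_def by metis
  have "\<exists>u. bounded_functional K u \<and> (\<forall>k. fourier_coeff u k = l (k, p, q))" for p q
  proof -
    have "(\<lambda>i. fourier_coeff (?u (r i) p q) k) \<longlonglongrightarrow> l (k, p, q)" for k
      using filterlim_compose[OF tendsto_eval l, of "(k, p, q)"] by (simp add: c_def)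
    then show ?thesis
      using bounded_functional_cluster[of K "\<lambda>i. ?u (r i) p q" "\<lambda>k. l (k, p, q)"] bf by metis
  qed
  then obtain U where U: "\<And>p q. bounded_functional K (U p q)"
    and Ul: "\<And>p q k. fourier_coeff (U p q) k = l (k, p, q)"
    by metis
  have "Hs_map_tendsto s (\<lambda>i. F (r i)) U"
    unfolding Hs_map_tendsto_def
  proof (intro allI bounded_functional_Hs_tendsto[OF bf U _ s])
    fix p q k
    show "(\<lambda>i. fourier_coeff (?u (r i) p q) k) \<longlonglongrightarrow> fourier_coeff (U p q) k"
      using filterlim_compose[OF tendsto_eval l, of "(k, p, q)"] by (simp add: c_def Ul)
  qed
  then show ?thesis using that[OF r] by blast
qed


section \<open>Almost reducible cocycles\<close>

lemma conjugated_cocycle_identity_component: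
  fixes G :: "(complex ^ 'n ^ 'n) set" and F :: "real ^ 'd \<Rightarrow> complex ^ 'n ^ 'n"
  assumes G: "compact_lie_group G" and F: "F \<in> Cinf_maps G" and S: "S \<in> identity_component G"
  shows "F y ** S ** mat_adjoint (F x) \<in> identity_component G"
proof -
  let ?C = "identity_component G"
  have FG: "F z \<in> G" for z using F by (simp add: Cinf_maps_def)
  have CG: "?C \<subseteq> G"
    by (simp add: identity_component_def connected_component_subset)
  define D where "D = (\<lambda>(z, R). F z ** R ** mat_adjoint (F x)) ` (UNIV \<times> ?C)"
  have "continuous_on UNIV F"
    using F by (simp add: Cinf_maps_def Cinf_torus_iff smooth_continuous_on)
  then have "continuous_on (UNIV \<times> ?C) (\<lambda>p. F (fst p))"
    by (rule continuous_on_compose2[OF _ continuous_on_fst[OF continuous_on_id]]) auto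
  then have "continuous_on (UNIV \<times> ?C) (\<lambda>p. F (fst p) ** snd p ** mat_adjoint (F x))"
    by (intro matrix_mult.continuous_on continuous_on_const continuous_on_snd continuous_on_id)
  then have "connected D"
    unfolding D_def case_prod_unfold
    by (intro connected_continuous_image connected_Times connected_UNIV)
      (auto simp: identity_component_def)
  moreover have one: "mat 1 \<in> ?C"
    using lie_group_one[OF G] by (simp add: identity_component_def)
  have "F x ** mat 1 ** mat_adjoint (F x) = mat 1"
    using lie_group_unitary[OF G FG[of x]] by simp
  then have "mat 1 \<in> D"
    unfolding D_def using one by (force intro!: image_eqI[of _ _ "(x, mat 1)"])
  moreover have "D \<subseteq> G"
    using CG FG lie_group_mult[OF G] lie_group_adjoint[OF G] by (auto simp: D_def)
  ultimately have "D \<subseteq> ?C"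
    unfolding identity_component_def by (intro connected_component_maximal)
  moreover have "F y ** S ** mat_adjoint (F x) \<in> D"
    unfolding D_def using S by (force intro!: image_eqI[of _ _ "(y, S)"])
  ultimately show ?thesis by blast
qed

lemma almost_reducible_Hs_conjugate_constant:
  fixes G T :: "(complex ^ 'n ^ 'n) set" and \<alpha> :: "real ^ 'd"
  assumes G: "compact_lie_group G" and T: "maximal_torus G T" and A: "A \<in> Cinf_maps G"
    and AC: "\<And>x. A x \<in> identity_component G" and red: "almost_reducible G (\<alpha>, A)"
    and s: "s \<le> - real CARD('d)"
  shows "\<exists>a\<in>lie_algebra T. Hs_conjugate s G (\<alpha>, A) (constant_cocycle \<alpha> (mat_exp a))"
proof -
  obtain H S where H: "\<And>i. H i \<in> Cinf_maps G" and S: "\<And>i. S i \<in> G"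
    and lim: "Cinf_tendsto (\<lambda>i x. matrix_inv (S i) ** H i (x + \<alpha>) ** A x ** matrix_inv (H i x)) (\<lambda>_. mat 1)"
    using red unfolding almost_reducible_def by auto
  have HG: "H i x \<in> G" for i x using H[of i] by (simp add: Cinf_maps_def)
  note SU = lie_group_unitary[OF G S] and HU = lie_group_unitary[OF G HG]
  define M where "M i x = mat_adjoint (S i) ** H i (x + \<alpha>) ** A x ** mat_adjoint (H i x)" for i x
  have limM: "Cinf_tendsto M (\<lambda>_. mat 1)"
    using lim by (simp add: M_def[abs_def] matrix_inv_unitary[OF SU] matrix_inv_unitary[OF HU])
  have smM: "smooth (M i)" for i
    unfolding M_def using H[of i] A
    by (intro smooth_matrix_mult smooth_const smooth_mat_adjoint smooth_translate)
      (auto simp: Cinf_maps_def Cinf_torus_iff)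
  have SM: "S i ** M i x = H i (x + \<alpha>) ** A x ** mat_adjoint (H i x)" for i x
    using SU by (simp add: M_def matrix_mul_assoc)
  obtain S0 r where r: "strict_mono r" and S0: "(S \<circ> r) \<longlonglongrightarrow> S0"
    using lie_group_compact[OF G] S unfolding compact_def by metis
  have Sr: "(\<lambda>i. S (r i)) \<longlonglongrightarrow> S0" using S0 by (simp add: o_def)
  have limMr: "Cinf_tendsto (\<lambda>i. M (r i)) (\<lambda>_. mat 1)"
    by (rule Cinf_tendsto_subseq[OF limM r])
  have "(\<lambda>i. S (r i) ** M (r i) 0) \<longlonglongrightarrow> S0 ** mat 1"
    by (intro matrix_mult.tendsto Sr Cinf_tendsto_pointwise[OF limMr])
  moreover have mem: "S (r i) ** M (r i) 0 \<in> identity_component G" for i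
    unfolding SM by (rule conjugated_cocycle_identity_component[OF G H AC])
  have "closed (identity_component G)"
    unfolding identity_component_def by (rule closed_connected_component[OF lie_group_closed[OF G]])
  then have "\<And>L. (\<lambda>i. S (r i) ** M (r i) 0) \<longlonglongrightarrow> L \<Longrightarrow> L \<in> identity_component G"
    by (rule closed_sequentially[OF _ mem])
  ultimately have "S0 ** mat 1 \<in> identity_component G" by blast
  then have "S0 \<in> identity_component G" by simp
  then obtain P where P: "P \<in> G" and PS0: "P ** S0 ** mat_adjoint P \<in> T"
    by (rule conjugate_into_maximal_torus[OF G T])
  have "torus_in G T" using T by (simp add: maximal_torus_def)
  then have "P ** S0 ** mat_adjoint P \<in> mat_exp ` lie_algebra T"
    using PS0 by (simp only: torus_exp_surj)
  then obtain a where a: "a \<in> lie_algebra T" and ea: "mat_exp a = P ** S0 ** mat_adjoint P"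
    by auto
  define F where "F i = (\<lambda>x. P ** H (r i) x)" for i
  have F: "F i \<in> Cinf_maps G" for i
    unfolding F_def by (rule Cinf_maps_mult_left[OF G P H])
  obtain r' U where r': "strict_mono r'" and U: "Hs_map_tendsto s (\<lambda>i. F (r' i)) U"
    by (rule Hs_map_convergent_subsequence[OF G F s])
  have "Conj (F i) (\<alpha>, A) = (\<alpha>, \<lambda>x. (P ** S (r i)) ** M (r i) x ** mat_adjoint P)" for i
  proof -
    have "F i (x + \<alpha>) ** A x ** matrix_inv (F i x) = (P ** S (r i)) ** M (r i) x ** mat_adjoint P" for x
    proof -
      have "matrix_inv (P ** H (r i) x) = mat_adjoint (P ** H (r i) x)"
        by (rule matrix_inv_unitary[OF lie_group_unitary[OF G lie_group_mult[OF G P HG]]])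
      then have "F i (x + \<alpha>) ** A x ** matrix_inv (F i x)
          = P ** (H (r i) (x + \<alpha>) ** A x ** mat_adjoint (H (r i) x)) ** mat_adjoint P"
        by (simp add: F_def matrix_mul_assoc)
      then show ?thesis
        by (simp only: SM[symmetric]) (simp add: matrix_mul_assoc)
    qed
    then show ?thesis by (simp add: Conj_def)
  qed
  moreover have "(\<lambda>i. P ** S (r i)) \<longlonglongrightarrow> P ** S0"
    by (intro matrix_mult.tendsto tendsto_const Sr)
  then have "Cinf_tendsto (\<lambda>i x. (P ** S (r i)) ** M (r i) x ** mat_adjoint P)
      (\<lambda>_. (P ** S0) ** mat 1 ** mat_adjoint P)"
    by (rule Cinf_tendsto_matrix_mult_const[OF smM limMr])
  then have "Cinf_tendsto (\<lambda>i x. (P ** S (r (r' i))) ** M (r (r' i)) x ** mat_adjoint P)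
      (\<lambda>_. (P ** S0) ** mat 1 ** mat_adjoint P)"
    by (rule Cinf_tendsto_subseq[OF _ r'])
  ultimately have "cocycle_tendsto (\<lambda>i. Conj (F (r' i)) (\<alpha>, A)) (constant_cocycle \<alpha> (mat_exp a))"
    by (simp add: cocycle_tendsto_def constant_cocycle_def ea)
  moreover have "U \<in> Hs_maps s G"
    unfolding Hs_maps_def using F U by (intro CollectI exI[of _ "\<lambda>i. F (r' i)"]) simp
  ultimately have "Hs_conjugate s G (\<alpha>, A) (constant_cocycle \<alpha> (mat_exp a))"
    unfolding Hs_conjugate_def using F U by (intro exI[of _ "\<lambda>i. F (r' i)"] exI[of _ U]) simp
  then show ?thesis using a by blast
qed

theorem theorem3p5:
  fixes G T :: "(complex ^ 'n ^ 'n) set" and \<alpha> :: "real ^ 'd"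
    and \<Phi> :: "('d, 'n) cocycle" and d' :: nat
  assumes "compact_lie_group G" and "lie_group_dim G = d'"
    and "maximal_torus G T"
    and "diophantine \<alpha>"
    and "\<Phi> \<in> cocycles G \<alpha>"
    and "\<And>x. snd \<Phi> x \<in> identity_component G"
    and "almost_reducible G \<Phi>"
  shows "\<exists>a\<in>lie_algebra T. rotation_vector G T \<Phi> a \<and>
           Hs_conjugate (- real CARD('d) - real d') G \<Phi> (constant_cocycle \<alpha> (mat_exp a))"
proof -
  obtain A where \<Phi>: "\<Phi> = (\<alpha>, A)" and A: "A \<in> Cinf_maps G"
    using assms(5) by (auto simp: cocycles_def)
  have "\<exists>a\<in>lie_algebra T. Hs_conjugate (- real CARD('d) - real d') G (\<alpha>, A)
      (constant_cocycle \<alpha> (mat_exp a))"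
    by (rule almost_reducible_Hs_conjugate_constant[OF assms(1,3) A])
      (use assms(6,7) in \<open>simp_all add: \<Phi>\<close>)
  then show ?thesis
    unfolding rotation_vector_def \<Phi> fst_conv by blast
qed

end
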